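(* Let $p>0$, $\zeta\in(0,p)$, $0<\alpha<0.5$, and for each market size $n$ set $\zeta_n=\zeta n^{-\alpha}$. In the $n$-th system let the payments be $\zeta_n$-perturbed from $p$, i.e. $P_i=p+\zeta_n\varepsilon_i$ with $\varepsilon_1,\dots,\varepsilon_n$ i.i.d. uniform on $\{-1,+1\}$, let $Z_i$ be the resulting equilibrium participation indicators and $D$ the demand. Put $\bar Z=\frac1n\sum_{i=1}^n Z_i$, $\bar D=D/n$, $\bar\varepsilon=\frac1n\sum_{i=1}^n\varepsilon_i$, $$\hat\Delta=\zeta_n^{-1}\,\frac{\sum_{i=1}^n (Z_i-\bar Z)(\varepsilon_i-\bar\varepsilon)}{\sum_{i=1}^n(\varepsilon_i-\bar\varepsilon)^2},\qquad \hat\Upsilon=\hat\Delta\Big/\left(1+\frac{p\,\bar D\,\hat\Delta\,\omega'(\bar D/\bar Z)}{\bar Z^2\,\omega(\bar D/\bar Z)}\right),$$ $$\hat\Gamma=\hat\Upsilon\left[r(\bar D/\bar Z)-p\,\omega(\bar D/\bar Z)-\big(r'(\bar D/\bar Z)-p\,\omega'(\bar D/\bar Z)\big)\bar D/\bar Z\right]-\omega(\bar D/\bar Z)\,\bar Z .$$ Then for every $\varepsilon>0$, $$\lim_{n\to\infty}\mathbb P\left(\left|\hat\Gamma-\frac{d}{dp}u_A(p)\right|>\varepsilon\right)=0,$$ where $A$ is the (random) global state and $u_a(\cdot)$ is the mean-field utility defined in the context.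
   Context: Notation: $\mathbb R_+=[0,\infty)$. A sequence of systems is indexed by the market size $n\in\mathbb N$. Demand: the global state $A$ takes values in a finite set $\mathcal A$. Conditionally on $A=a$, the demand $D\ge 0$ (depending on $n$) satisfies, for some $d_a>0$: $\mathbb E[D/n\mid A=a]=d_a$ for all $n$; $\lim_{n\to\infty}\mathbb E[(D/n-d_a)^2\mid A=a]=0$; $\mathbb P(D/n\notin[d_a/2,2d_a]\mid A=a)=o(1/n)$. Suppliers: there are $n$ suppliers. Given a payment distribution $\pi$ on $\mathbb R_+$, payments $P_1,\dots,P_n$ are i.i.d. from $\pi$. Private features $B_1,\dots,B_n\in\mathcal B$ are i.i.d. given $A$, with law depending only on $A$. Conditionally on $A$, the variables $D$, $(B_i)$, $(P_i)$ are independent. $Z_i\in\{0,1\}$ indicates that supplier $i$ is active; $T_{\rm act}=\sum_i Z_i$. $S_i$ is the demand an active supplier $i$ serves (demand is randomly matched, irrespective of payments) and $\Omega(d,t)=\mathbb E[S_i\mid D=d,T_{\rm act}=t]$. Regular allocation function: $\omega:\mathbb R_+\to[0,1]$ smooth, concave, non-decreasing, with $\lim_{x\to0}\omega(x)=0$, $\lim_{x\to\infty}\omega(x)\le1$, $\lim_{x\to0}\omega'(x)\le1$. Assumption on $\Omega$: $\Omega:\mathbb R_+^2\to\mathbb R_+$ is non-decreasing in $d$, non-increasing in $t$, and $\Omega(d,t)=\omega(d/t)+l(d,t)$ with $\omega$ a regular allocation function and $l$ bounded with $|l(d,t)|=o(1/\sqrt t+1/\sqrt d)$ (at $t=0$,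 $\omega(d/t)$ is read as $\lim_{x\to\infty}\omega(x)$). Choice model: suppliers know $a$ and $\pi$. Conditionally on $A=a$, supplier $i$ becomes active independently with probability $f_{B_i}\big(P_i\,\mathbb E_\pi[\Omega(D,T_{\rm act})\mid A=a]\big)$, where $T_{\rm act}$ is the equilibrium number of active suppliers, i.e. a random variable (independent of $D$ given $A$) whose law coincides with that of the number of active suppliers resulting from these choices (conditionally on $A=a$ this equilibrium exists, is unique in law and binomial). For every $b\in\mathcal B$, $f_b$ takes values in $[0,1]$, is non-decreasing and twice differentiable, with second derivative bounded uniformly in $b$. Revenue: the platform's utility is $U=R(D,T_{\rm act})-\sum_iP_iZ_iS_i$, where $R(d,t)=(r(d/t)-l_R(d,t))\,t$ for $d,t\in\mathbb R_+$ (read as $0$ at $t=0$), $r:\mathbb R_+\to\mathbb R$ is smooth with bounded derivatives and $l_R$ is bounded with $|l_R(d,t)|=o(1/\sqrt t+1/\sqrt d)$. Mean-field quantities: $\mu_a(p)$ is the unique solution of $\mu=\mathbb E[f_{B_1}(p\,\omega(d_a/\mu))\mid A=a]$, and $u_a(p)=\big(r(d_a/\mu_a(p))-p\,\omega(d_a/\mu_a(p))\big)\mu_a(p)$. *)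

theory Defs
  imports "HOL-Probability.Probability" "HOL-Library.Landau_Symbols"
begin

section \<open>Calculus on the half-line\<close>

text \<open>Functions on \<open>[0,\<infinity>)\<close> are total functions on the reals whose values at negative
  arguments are irrelevant; their derivative is therefore taken within \<open>{0..}\<close>
  (one-sided at \<open>0\<close>, the usual derivative elsewhere).\<close>

definition hderiv :: "(real \<Rightarrow> real) \<Rightarrow> real \<Rightarrow> real" where
  "hderiv g x = vector_derivative g (at x within {0..})"

definition smooth_half :: "(real \<Rightarrow> real) \<Rightarrow> bool" where
  "smooth_half g \<longleftrightarrow> (\<forall>k. (hderiv ^^ k) g differentiable_on {0..})"


section \<open>Allocation, choice and revenue functions\<close>

definition regular_allocation :: "(real \<Rightarrow> real) \<Rightarrow> bool" where
  "regular_allocation \<omega> \<longleftrightarrow>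
     (\<forall>x\<ge>0. 0 \<le> \<omega> x \<and> \<omega> x \<le> 1) \<and>
     smooth_half \<omega> \<and> concave_on {0..} \<omega> \<and> mono_on {0..} \<omega> \<and>
     (\<omega> \<longlongrightarrow> 0) (at_right 0) \<and>
     (\<exists>L\<le>1. (\<omega> \<longlongrightarrow> L) at_top) \<and>
     (\<exists>L\<le>1. (hderiv \<omega> \<longlongrightarrow> L) (at_right 0))"

text \<open>The bound on the error terms is uniform as both \<open>d\<close> and \<open>t\<close> tend to infinity.\<close>

definition error_term :: "(real \<Rightarrow> real \<Rightarrow> real) \<Rightarrow> bool" where
  "error_term l \<longleftrightarrow>
     (\<exists>C. \<forall>d\<ge>0. \<forall>t\<ge>0. \<bar>l d t\<bar> \<le> C) \<and>
     (\<lambda>(d, t). l d t) \<in> o[at_top \<times>\<^sub>F at_top](\<lambda>(d, t). 1 / sqrt t + 1 / sqrt d)"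

definition allocation_function :: "(real \<Rightarrow> real) \<Rightarrow> (real \<Rightarrow> real \<Rightarrow> real) \<Rightarrow> bool" where
  "allocation_function \<omega> \<Omega> \<longleftrightarrow>
     regular_allocation \<omega> \<and>
     (\<forall>d\<ge>0. \<forall>t\<ge>0. 0 \<le> \<Omega> d t) \<and>
     (\<forall>t\<ge>0. mono_on {0..} (\<lambda>d. \<Omega> d t)) \<and>
     (\<forall>d\<ge>0. antimono_on {0..} (\<Omega> d)) \<and>
     (\<exists>l. error_term l \<and>
        (\<forall>d\<ge>0. \<forall>t\<ge>0. \<Omega> d t = (if t = 0 then Lim at_top \<omega> else \<omega> (d / t)) + l d t))"

definition choice_functions :: "'b measure \<Rightarrow> ('b \<Rightarrow> real \<Rightarrow> real) \<Rightarrow> bool" where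
  "choice_functions \<B> f \<longleftrightarrow>
     (\<forall>x\<ge>0. (\<lambda>b. f b x) \<in> borel_measurable \<B>) \<and>
     (\<forall>b\<in>space \<B>. (\<forall>x\<ge>0. 0 \<le> f b x \<and> f b x \<le> 1) \<and> mono_on {0..} (f b) \<and>
        f b differentiable_on {0..} \<and> hderiv (f b) differentiable_on {0..}) \<and>
     (\<exists>C. \<forall>b\<in>space \<B>. \<forall>x\<ge>0. \<bar>hderiv (hderiv (f b)) x\<bar> \<le> C)"

definition revenue_function :: "(real \<Rightarrow> real) \<Rightarrow> (real \<Rightarrow> real \<Rightarrow> real) \<Rightarrow> bool" where
  "revenue_function r R \<longleftrightarrow>
     smooth_half r \<and> (\<forall>k\<ge>1. bounded ((hderiv ^^ k) r ` {0..})) \<and>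
     (\<exists>l. error_term l \<and>
        (\<forall>d\<ge>0. \<forall>t\<ge>0. R d t = (if t = 0 then 0 else (r (d / t) - l d t) * t)))"


section \<open>One market in equilibrium\<close>

definition given_state :: "'w measure \<Rightarrow> ('w \<Rightarrow> 'a) \<Rightarrow> 'a \<Rightarrow> 'w measure" where
  "given_state M A a = uniform_measure M {w \<in> space M. A w = a}"

text \<open>A market with \<open>n\<close> suppliers, indexed by \<open>{..<n}\<close>. The global state \<open>A\<close> has law \<open>\<rho>\<close>, so
  that the states on which one can condition are the elements of \<open>set_pmf \<rho>\<close>; given \<open>A = a\<close> the
  private features have law \<open>\<nu> a\<close> on the measurable space \<open>\<B>\<close>. Payments have law \<open>\<pi>\<close>.\<close>

locale market = prob_space M
  for M :: "'w measure"
  and n :: nat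
  and \<rho> :: "'a pmf"
  and \<B> :: "'b measure"
  and \<nu> :: "'a \<Rightarrow> 'b measure"
  and \<pi> :: "real measure"
  and f :: "'b \<Rightarrow> real \<Rightarrow> real"
  and \<Omega> :: "real \<Rightarrow> real \<Rightarrow> real"
  and A :: "'w \<Rightarrow> 'a"
  and D :: "'w \<Rightarrow> real"
  and B :: "nat \<Rightarrow> 'w \<Rightarrow> 'b"
  and P Z S :: "nat \<Rightarrow> 'w \<Rightarrow> real" +
  fixes T :: "'w \<Rightarrow> real"
    and \<Omega>bar :: "'a \<Rightarrow> real"
    and primitives :: "'w \<Rightarrow> real \<times> (nat \<Rightarrow> 'b) \<times> (nat \<Rightarrow> real)"
    and primitives_space :: "(real \<times> (nat \<Rightarrow> 'b) \<times> (nat \<Rightarrow> real)) measure"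
  defines "T \<equiv> \<lambda>w. \<Sum>i<n. Z i w"
    and "\<Omega>bar \<equiv> \<lambda>a. \<integral>w. \<Omega> (D w) (T w) \<partial>given_state M A a"
    and "primitives \<equiv> \<lambda>w. (D w, \<lambda>i\<in>{..<n}. B i w, \<lambda>i\<in>{..<n}. P i w)"
    and "primitives_space \<equiv>
           borel \<Otimes>\<^sub>M (Pi\<^sub>M {..<n} (\<lambda>_. \<B>) \<Otimes>\<^sub>M Pi\<^sub>M {..<n} (\<lambda>_. borel))"
  assumes payment_law: "prob_space \<pi>" "sets \<pi> = sets borel" "AE x in \<pi>. 0 \<le> x"
    and feature_law: "\<And>a. a \<in> set_pmf \<rho> \<Longrightarrow> prob_space (\<nu> a) \<and> sets (\<nu> a) = sets \<B>"
    and state: "A \<in> M \<rightarrow>\<^sub>M count_space UNIV" "distr M (count_space UNIV) A = measure_pmf \<rho>"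
    and demand: "D \<in> borel_measurable M" "\<And>w. w \<in> space M \<Longrightarrow> 0 \<le> D w"
    and feature: "\<And>i. i < n \<Longrightarrow> B i \<in> M \<rightarrow>\<^sub>M \<B>"
    and payment: "\<And>i. i < n \<Longrightarrow> P i \<in> borel_measurable M"
    and active: "\<And>i. i < n \<Longrightarrow> Z i \<in> borel_measurable M"
      "\<And>i w. i < n \<Longrightarrow> w \<in> space M \<Longrightarrow> Z i w \<in> {0, 1}"
    and served: "\<And>i. i < n \<Longrightarrow> S i \<in> borel_measurable M"
      "\<And>i w. i < n \<Longrightarrow> w \<in> space M \<Longrightarrow> 0 \<le> S i w"
    \<comment> \<open>Given \<open>A = a\<close>: independence of \<open>D\<close>, the \<open>B i\<close> and the \<open>P i\<close>, and the laws of the latter two.\<close>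
    and primitives_law: "\<And>a. a \<in> set_pmf \<rho> \<Longrightarrow>
      distr (given_state M A a) primitives_space primitives =
        distr (given_state M A a) borel D \<Otimes>\<^sub>M
          (Pi\<^sub>M {..<n} (\<lambda>_. \<nu> a) \<Otimes>\<^sub>M Pi\<^sub>M {..<n} (\<lambda>_. \<pi>))"
    \<comment> \<open>Given \<open>A = a\<close> and the primitives, the \<open>0\<close>-\<open>1\<close> variables \<open>Z i\<close> are independent with
      success probability \<open>f (B i) (P i * \<Omega>bar a)\<close>. As \<open>\<Omega>bar a\<close> is computed from \<open>T\<close>, the number
      of active suppliers that results from these very choices, this is the equilibrium condition.\<close>
    and choice: "\<And>a J. a \<in> set_pmf \<rho> \<Longrightarrow> J \<subseteq> {..<n} \<Longrightarrow>
      AE w in given_state M A a.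
        real_cond_exp (given_state M A a) (vimage_algebra (space M) primitives primitives_space)
          (\<lambda>w. \<Prod>i\<in>J. Z i w) w
        = (\<Prod>i\<in>J. f (B i w) (P i w * \<Omega>bar a))"
    \<comment> \<open>\<open>\<Omega> d t\<close> is the mean of \<open>S i\<close> given \<open>D = d\<close> and \<open>T = t\<close>, for an active supplier \<open>i\<close>.\<close>
    and matching: "\<And>i. i < n \<Longrightarrow> integrable (uniform_measure M {w \<in> space M. Z i w = 1}) (S i)"
      "\<And>i. i < n \<Longrightarrow> AE w in uniform_measure M {w \<in> space M. Z i w = 1}.
        real_cond_exp (uniform_measure M {w \<in> space M. Z i w = 1})
          (vimage_algebra (space M) (\<lambda>w. (D w, T w)) (borel \<Otimes>\<^sub>M borel)) (S i) w
        = \<Omega> (D w) (T w)"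
begin

definition platform_utility :: "(real \<Rightarrow> real \<Rightarrow> real) \<Rightarrow> 'w \<Rightarrow> real" where
  "platform_utility R w = R (D w) (T w) - (\<Sum>i<n. P i w * Z i w * S i w)"

end

definition demand_scaling ::
  "(nat \<Rightarrow> 'w measure) \<Rightarrow> (nat \<Rightarrow> 'w \<Rightarrow> 'a) \<Rightarrow> (nat \<Rightarrow> 'w \<Rightarrow> real) \<Rightarrow> 'a \<Rightarrow> real \<Rightarrow> bool" where
  "demand_scaling M A D a da \<longleftrightarrow>
     0 < da \<and>
     (\<forall>n\<ge>1. integrable (given_state (M n) (A n) a) (D n) \<and>
        (\<integral>w. D n w / real n \<partial>given_state (M n) (A n) a) = da) \<and>
     (\<lambda>n. \<integral>\<^sup>+w. ennreal ((D n w / real n - da)\<^sup>2) \<partial>given_state (M n) (A n) a) \<longlonglongrightarrow> 0 \<and>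
     (\<lambda>n. measure (given_state (M n) (A n) a)
        {w \<in> space (M n). D n w / real n \<notin> {da / 2..2 * da}}) \<in> o(\<lambda>n. 1 / real n)"


section \<open>Mean-field quantities\<close>

text \<open>\<open>\<nu>\<close> and \<open>d\<close> are the feature law and the scaled demand in one fixed state. A balanced
  participation rate is positive, so that \<open>d / \<mu>\<close> is meaningful.\<close>

definition balanced ::
  "('b \<Rightarrow> real \<Rightarrow> real) \<Rightarrow> (real \<Rightarrow> real) \<Rightarrow> 'b measure \<Rightarrow> real \<Rightarrow> real \<Rightarrow> real \<Rightarrow> bool" where
  "balanced f \<omega> \<nu> d p \<mu> \<longleftrightarrow> 0 < \<mu> \<and> \<mu> = (\<integral>b. f b (p * \<omega> (d / \<mu>)) \<partial>\<nu>)"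

definition mf_rate ::
  "('b \<Rightarrow> real \<Rightarrow> real) \<Rightarrow> (real \<Rightarrow> real) \<Rightarrow> 'b measure \<Rightarrow> real \<Rightarrow> real \<Rightarrow> real" where
  "mf_rate f \<omega> \<nu> d p = (THE \<mu>. balanced f \<omega> \<nu> d p \<mu>)"

definition mf_utility ::
  "(real \<Rightarrow> real) \<Rightarrow> ('b \<Rightarrow> real \<Rightarrow> real) \<Rightarrow> (real \<Rightarrow> real) \<Rightarrow> 'b measure \<Rightarrow> real \<Rightarrow> real \<Rightarrow> real" where
  "mf_utility r f \<omega> \<nu> d p =
     (let \<mu> = mf_rate f \<omega> \<nu> d p in (r (d / \<mu>) - p * \<omega> (d / \<mu>)) * \<mu>)"


section \<open>Local experimentation\<close>

definition perturbed_payment :: "real \<Rightarrow> real \<Rightarrow> real measure" where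
  "perturbed_payment p z = distr (measure_pmf (pmf_of_set {-1, 1})) borel (\<lambda>e. p + z * e)"

definition average :: "nat \<Rightarrow> (nat \<Rightarrow> real) \<Rightarrow> real" where
  "average n x = (\<Sum>i<n. x i) / real n"

definition Delta_hat :: "nat \<Rightarrow> real \<Rightarrow> (nat \<Rightarrow> real) \<Rightarrow> (nat \<Rightarrow> real) \<Rightarrow> real" where
  "Delta_hat n z Z e =
     inverse z * ((\<Sum>i<n. (Z i - average n Z) * (e i - average n e)) /
       (\<Sum>i<n. (e i - average n e)\<^sup>2))"

definition Upsilon_hat :: "real \<Rightarrow> (real \<Rightarrow> real) \<Rightarrow> real \<Rightarrow> real \<Rightarrow> real \<Rightarrow> real" where
  "Upsilon_hat p \<omega> Dbar Zbar \<Delta> =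
     \<Delta> / (1 + p * Dbar * \<Delta> * hderiv \<omega> (Dbar / Zbar) / (Zbar\<^sup>2 * \<omega> (Dbar / Zbar)))"

definition Gamma_hat ::
  "real \<Rightarrow> (real \<Rightarrow> real) \<Rightarrow> (real \<Rightarrow> real) \<Rightarrow> real \<Rightarrow> real \<Rightarrow> real \<Rightarrow> real" where
  "Gamma_hat p \<omega> r Dbar Zbar \<Delta> =
     Upsilon_hat p \<omega> Dbar Zbar \<Delta> *
       (r (Dbar / Zbar) - p * \<omega> (Dbar / Zbar)
        - (hderiv r (Dbar / Zbar) - p * hderiv \<omega> (Dbar / Zbar)) * (Dbar / Zbar))
     - \<omega> (Dbar / Zbar) * Zbar"

end

theory Submission
  imports Defs
begin

text \<open>
  Fix a state and write \<open>g\<close> for the mean choice function and \<open>X\<close> for the mean allocation in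
  equilibrium. Given the state, the pairs of payment and participation are independent, so
  Chebyshev's inequality concentrates the average participation and the average of \<open>Z \<epsilon>\<close> at
  \<open>(g ((p + \<zeta>) X) + g ((p - \<zeta>) X)) / 2\<close> and \<open>(g ((p + \<zeta>) X) - g ((p - \<zeta>) X)) / 2\<close>, with error
  \<open>O(1 / sqrt n)\<close>; as \<open>\<alpha> < 1 / 2\<close>, this error is negligible even after division by \<open>\<zeta>\<close>. No rate is
  needed for \<open>X\<close>: as \<open>\<Omega>\<close> is monotone, a participation rate that stays below (above) the
  mean-field rate would push \<open>X\<close>, hence the participation rate itself, above (below) it. So the
  regression slope tends to the partial derivative of participation in \<open>p\<close>, the correction
  \<open>Upsilon_hat\<close> turns it into the derivative of the mean-field rate, and continuity of
  \<open>Gamma_hat\<close> finishes the proof.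
\<close>

section \<open>Functions on the half-line and mean choices\<close>

text \<open>Given the state, the mean allocation \<open>X\<close> is a number, so equilibrium
  feedback cannot correlate the suppliers; the difficulty is to locate \<open>X\<close>. Two facts
  replace a rate of convergence for it. In the gradient of participation the arguments
  \<open>(p + \<zeta>) * X\<close> and \<open>(p - \<zeta>) * X\<close> contain the same
  \<open>X\<close>, so an error in \<open>X\<close> is never divided by \<open>\<zeta>\<close>. And
  \<open>m - g (p * \<omega> (d / m))\<close> is strictly increasing in \<open>m > 0\<close>, so the
  mean-field rate is its only zero and can be trapped from both sides. The regression slope
  \<open>s\<close> sees a change of one's own payment at a frozen allocation, whereas the mean-field
  rate also reacts through \<open>\<omega> (d / \<mu>)\<close>. Implicit differentiation of the
  balance equation divides \<open>s\<close> by
  \<open>1 + p * d * s * \<omega>' / (\<mu>\<^sup>2 * \<omega>)\<close>, which is the denominator of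
  \<open>Upsilon_hat\<close>; at \<open>\<omega> = 0\<close> the convention \<open>x / 0 = 0\<close>
  has to be reconciled with it. Derivatives are one-sided at \<open>0\<close>, and \<open>0\<close>
  is a possible reward, so the calculus is done within the half-line.\<close>

lemma hderiv_works:
  assumes "g differentiable_on {0..}" "0 \<le> x"
  shows "(g has_real_derivative hderiv g x) (at x within {0..})"
  using assms unfolding hderiv_def differentiable_on_def has_real_derivative_iff_has_vector_derivative
  by (auto simp flip: vector_derivative_works)

text \<open>The mean value theorem needs derivatives only strictly between \<open>u\<close> and
  \<open>v\<close>, where the half-line is a full neighbourhood; this covers \<open>u = 0\<close> as
  well.\<close>

lemma MVT_half_line:
  fixes g g' :: "real \<Rightarrow> real"
  assumes der: "\<And>x. 0 \<le> x \<Longrightarrow> (g has_real_derivative g' x) (at x within {0..})"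
    and "0 \<le> u" "u < v"
  obtains \<xi> where "u < \<xi>" "\<xi> < v" "g v - g u = (v - u) * g' \<xi>"
proof -
  have "continuous_on {0..} g"
    using der DERIV_continuous by (fastforce simp: continuous_on_eq_continuous_within)
  then have "continuous_on {u..v} g"
    by (rule continuous_on_subset) (use assms in auto)
  moreover have "(g has_derivative (*) (g' x)) (at x)" if "u < x" "x < v" for x
    using der[of x] that assms(2) at_within_interior[of x "{0..}"]
    by (simp add: has_field_derivative_def)
  ultimately obtain \<xi> where "u < \<xi>" "\<xi> < v" "g v - g u = g' \<xi> * (v - u)"
    using mvt[OF \<open>u < v\<close>, of g "\<lambda>x. (*) (g' x)"] by auto
  then show ?thesis by (intro that[of \<xi>]) (auto simp: mult.commute)
qed

lemma DERIV_interior_half_line: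
  fixes x :: real
  assumes "(g has_real_derivative D) (at x within {0..})" "0 < x"
  shows "(g has_real_derivative D) (at x)"
  using assms at_within_interior[of x "{0..}"] by simp

text \<open>Only difference quotients to the right of \<open>x\<close> are used, since these are
  available at every point of the half-line, including \<open>0\<close>.\<close>

lemma nonneg_derivative_half_line:
  fixes g :: "real \<Rightarrow> real"
  assumes "(g has_real_derivative D) (at x within {0..})" "mono_on {0..} g" "0 \<le> x"
  shows "0 \<le> D"
proof -
  have "((\<lambda>y. (g y - g x) / (y - x)) \<longlongrightarrow> D) (at x within {x<..})"
    using assms(1,3) by (auto simp: has_field_derivative_iff intro: tendsto_within_subset)
  moreover have "\<forall>\<^sub>F y in at x within {x<..}. 0 \<le> (g y - g x) / (y - x)"
    using assms(2,3) by (auto simp: eventually_at_filter mono_on_def intro!: always_eventually)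
  ultimately show ?thesis
    by (intro tendsto_lowerbound[of _ D "at x within {x<..}"]) auto
qed

definition mean_choice :: "('b \<Rightarrow> real \<Rightarrow> real) \<Rightarrow> 'b measure \<Rightarrow> real \<Rightarrow> real" where
  "mean_choice f \<nu> x = (\<integral>b. f b x \<partial>\<nu>)"

text \<open>Defined as the mean of the derivatives; that it is the derivative of the mean is the
  content of \<open>mean_deriv\<close>.\<close>

definition mean_slope :: "('b \<Rightarrow> real \<Rightarrow> real) \<Rightarrow> 'b measure \<Rightarrow> real \<Rightarrow> real" where
  "mean_slope f \<nu> x = (\<integral>b. hderiv (f b) x \<partial>\<nu>)"

locale choice_law = prob_space \<nu> for \<nu> :: "'b measure" +
  fixes \<B> :: "'b measure" and f :: "'b \<Rightarrow> real \<Rightarrow> real"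
  assumes sets_eq: "sets \<nu> = sets \<B>" and choice_functions: "choice_functions \<B> f"
begin

abbreviation "g \<equiv> mean_choice f \<nu>"
abbreviation "g' \<equiv> mean_slope f \<nu>"

lemma space_eq: "space \<nu> = space \<B>"
  using sets_eq by (rule sets_eq_imp_space_eq)

lemma f_measurable: "0 \<le> x \<Longrightarrow> (\<lambda>b. f b x) \<in> borel_measurable \<nu>"
  using choice_functions measurable_cong_sets[OF sets_eq refl, of borel]
  by (auto simp: choice_functions_def)

lemma f_range: "b \<in> space \<nu> \<Longrightarrow> 0 \<le> x \<Longrightarrow> 0 \<le> f b x \<and> f b x \<le> 1"
  using choice_functions by (auto simp: choice_functions_def space_eq)

lemma f_mono: "b \<in> space \<nu> \<Longrightarrow> mono_on {0..} (f b)"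
  using choice_functions by (auto simp: choice_functions_def space_eq)

lemma f_deriv: "b \<in> space \<nu> \<Longrightarrow> 0 \<le> x \<Longrightarrow>
    (f b has_real_derivative hderiv (f b) x) (at x within {0..})"
  using choice_functions by (auto simp: choice_functions_def space_eq intro: hderiv_works)

lemma f_integrable: "0 \<le> x \<Longrightarrow> integrable \<nu> (\<lambda>b. f b x)"
  by (intro integrable_const_bound[where B = 1] AE_I2 f_measurable) (use f_range in auto)

text \<open>Measurability in \<open>b\<close> is given for the values of \<open>f\<close>, so the
  slope is written as a limit of difference quotients. The steps \<open>1 / (k + 1)\<close> are
  positive and stay in the half-line even when \<open>x = 0\<close>.\<close>

lemma slope_measurable:
  assumes "0 \<le> x"
  shows "(\<lambda>b. hderiv (f b) x) \<in> borel_measurable \<nu>"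
proof (rule borel_measurable_LIMSEQ_real)
  fix b assume b: "b \<in> space \<nu>"
  have "filterlim (\<lambda>k. x + inverse (real (Suc k))) (at x within {0..}) sequentially"
    unfolding filterlim_at
    using assms tendsto_add[OF tendsto_const[of x] LIMSEQ_inverse_real_of_nat] by auto
  then have "(\<lambda>k. (f b (x + inverse (real (Suc k))) - f b x) / (x + inverse (real (Suc k)) - x))
      \<longlonglongrightarrow> hderiv (f b) x"
    using f_deriv[OF b assms] unfolding has_field_derivative_iff
    by (rule filterlim_compose[rotated])
  then show "(\<lambda>k. (f b (x + inverse (real (Suc k))) - f b x) / (x + inverse (real (Suc k)) - x))
      \<longlonglongrightarrow> hderiv (f b) x" .
next
  show "(\<lambda>b. (f b (x + inverse (real (Suc k))) - f b x) / (x + inverse (real (Suc k)) - x))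
      \<in> borel_measurable \<nu>" for k
    using assms by (intro borel_measurable_divide borel_measurable_diff f_measurable) auto
qed

text \<open>The uniform bound on second derivatives gives one Lipschitz constant for all features,
  which lets the estimates survive averaging over \<open>b\<close>. Taking \<open>max C 0\<close>
  spares an argument about the sign of \<open>C\<close>.\<close>

lemma slope_Lipschitz:
  obtains C where "0 \<le> C"
    "\<And>b x y. b \<in> space \<nu> \<Longrightarrow> 0 \<le> x \<Longrightarrow> 0 \<le> y \<Longrightarrow>
       \<bar>hderiv (f b) x - hderiv (f b) y\<bar> \<le> C * \<bar>x - y\<bar>"
proof -
  obtain C where C: "\<And>b x. b \<in> space \<nu> \<Longrightarrow> 0 \<le> x \<Longrightarrow> \<bar>hderiv (hderiv (f b)) x\<bar> \<le> C"
    using choice_functions unfolding choice_functions_def space_eq by blast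
  have lt: "\<bar>hderiv (f b) y - hderiv (f b) x\<bar> \<le> max C 0 * \<bar>y - x\<bar>"
    if b: "b \<in> space \<nu>" and xy: "0 \<le> x" "x < y" for b x y
  proof -
    have "hderiv (f b) differentiable_on {0..}"
      using choice_functions b by (auto simp: choice_functions_def space_eq)
    then obtain \<xi> where "x < \<xi>" "hderiv (f b) y - hderiv (f b) x = (y - x) * hderiv (hderiv (f b)) \<xi>"
      using MVT_half_line[OF hderiv_works xy] by metis
    then show ?thesis using C[OF b, of \<xi>] xy
      by (auto simp: abs_mult mult.commute[of "y - x"] intro!: mult_right_mono)
  qed
  show ?thesis
  proof (rule that[of "max C 0"])
    fix b and x y :: real assume "b \<in> space \<nu>" "0 \<le> x" "0 \<le> y"
    then show "\<bar>hderiv (f b) x - hderiv (f b) y\<bar> \<le> max C 0 * \<bar>x - y\<bar>"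
      using lt[of b x y] lt[of b y x] by (cases x y rule: linorder_cases) (auto simp: abs_minus_commute)
  qed simp
qed

lemma integral_bound_pointwise:
  fixes h :: "'b \<Rightarrow> real"
  assumes "integrable \<nu> h" "\<And>b. b \<in> space \<nu> \<Longrightarrow> \<bar>h b\<bar> \<le> k"
  shows "\<bar>\<integral>b. h b \<partial>\<nu>\<bar> \<le> (\<integral>b. k \<partial>\<nu>)"
  using assms by (intro order_trans[OF integral_abs_bound] integral_mono) auto

text \<open>Slopes are bounded: over \<open>[x, x + 1]\<close> the value of \<open>f b\<close>
  changes by at most \<open>1\<close>, so some slope there is at most \<open>1\<close> in absolute
  value, and the Lipschitz bound carries this back to \<open>x\<close>.\<close>

lemma slope_integrable:
  assumes "0 \<le> x"
  shows "integrable \<nu> (\<lambda>b. hderiv (f b) x)"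
proof -
  obtain C where C: "0 \<le> C" "\<And>b x y. b \<in> space \<nu> \<Longrightarrow> 0 \<le> x \<Longrightarrow> 0 \<le> y \<Longrightarrow>
       \<bar>hderiv (f b) x - hderiv (f b) y\<bar> \<le> C * \<bar>x - y\<bar>"
    using slope_Lipschitz by blast
  have "\<bar>hderiv (f b) x\<bar> \<le> 1 + C" if b: "b \<in> space \<nu>" for b
  proof -
    obtain \<xi> where \<xi>: "x < \<xi>" "\<xi> < x + 1" "f b (x + 1) - f b x = (x + 1 - x) * hderiv (f b) \<xi>"
      using MVT_half_line[OF f_deriv[OF b] assms, of "x + 1"] by auto
    have "C * \<bar>\<xi> - x\<bar> \<le> C * 1" using \<xi> C by (intro mult_left_mono) auto
    then show ?thesis using C(2)[OF b, of \<xi> x] \<xi> assms f_range[OF b, of x] f_range[OF b, of "x + 1"]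
      by auto
  qed
  then show ?thesis
    by (intro integrable_const_bound[where B = "1 + C"] AE_I2 slope_measurable assms) auto
qed

lemma mean_mono: "mono_on {0..} g"
  unfolding mean_choice_def using f_mono
  by (auto intro!: mono_onI integral_mono f_integrable simp: mono_on_def)

lemma mean_slope_continuous: "continuous_on {0..} g'"
proof -
  obtain C where C: "0 \<le> C" "\<And>b x y. b \<in> space \<nu> \<Longrightarrow> 0 \<le> x \<Longrightarrow> 0 \<le> y \<Longrightarrow>
       \<bar>hderiv (f b) x - hderiv (f b) y\<bar> \<le> C * \<bar>x - y\<bar>"
    using slope_Lipschitz by blast
  have "C-lipschitz_on {0..} g'"
  proof (rule lipschitz_onI)
    fix x y :: real assume xy: "x \<in> {0..}" "y \<in> {0..}"
    have "\<bar>g' x - g' y\<bar> = \<bar>\<integral>b. hderiv (f b) x - hderiv (f b) y \<partial>\<nu>\<bar>"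
      unfolding mean_slope_def using xy by (simp add: slope_integrable)
    also have "\<dots> \<le> (\<integral>b. C * \<bar>x - y\<bar> \<partial>\<nu>)"
      using xy C(2) by (intro integral_bound_pointwise) (auto intro!: slope_integrable)
    finally show "dist (g' x) (g' y) \<le> C * dist x y"
      by (simp add: dist_real_def prob_space)
  qed (use C in auto)
  then show ?thesis by (rule lipschitz_on_continuous_on)
qed

text \<open>Differentiation under the integral without dominated convergence: the difference
  quotient of \<open>f b\<close> misses its slope by at most a constant times the distance of
  \<open>y\<close> and \<open>x\<close>, uniformly in \<open>b\<close>, and this bound passes to the
  mean.\<close>

lemma mean_deriv:
  assumes x: "0 \<le> x"
  shows "(g has_real_derivative g' x) (at x within {0..})"
proof -
  obtain C where C: "0 \<le> C" "\<And>b x y. b \<in> space \<nu> \<Longrightarrow> 0 \<le> x \<Longrightarrow> 0 \<le> y \<Longrightarrow>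
       \<bar>hderiv (f b) x - hderiv (f b) y\<bar> \<le> C * \<bar>x - y\<bar>"
    using slope_Lipschitz by blast
  have pt: "\<bar>(f b y - f b x) / (y - x) - hderiv (f b) x\<bar> \<le> C * \<bar>y - x\<bar>"
    if b: "b \<in> space \<nu>" and y: "0 \<le> y" "y \<noteq> x" for b y
  proof -
    obtain \<xi> where \<xi>: "\<bar>\<xi> - x\<bar> \<le> \<bar>y - x\<bar>" "0 \<le> \<xi>" "(f b y - f b x) / (y - x) = hderiv (f b) \<xi>"
    proof (cases "x < y")
      case True
      then obtain \<xi> where "x < \<xi>" "\<xi> < y" "f b y - f b x = (y - x) * hderiv (f b) \<xi>"
        using MVT_half_line[OF f_deriv[OF b] x, of y] by auto
      then show ?thesis using True x by (intro that[of \<xi>]) auto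
    next
      case False
      then obtain \<xi> where "y < \<xi>" "\<xi> < x" "f b x - f b y = (x - y) * hderiv (f b) \<xi>"
        using MVT_half_line[OF f_deriv[OF b] y(1), of x] y by auto
      then show ?thesis using False x y by (intro that[of \<xi>]) (auto simp: field_simps)
    qed
    have "\<bar>hderiv (f b) \<xi> - hderiv (f b) x\<bar> \<le> C * \<bar>\<xi> - x\<bar>" using C(2) b \<xi> x by auto
    also have "\<dots> \<le> C * \<bar>y - x\<bar>" using \<xi> C by (intro mult_left_mono) auto
    finally show ?thesis using \<xi> by simp
  qed
  have "\<bar>(g y - g x) / (y - x) - g' x\<bar> \<le> C * \<bar>y - x\<bar>" if y: "0 \<le> y" "y \<noteq> x" for y
  proof -
    have "(g y - g x) / (y - x) - g' x = (\<integral>b. (f b y - f b x) / (y - x) - hderiv (f b) x \<partial>\<nu>)"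
      unfolding mean_slope_def mean_choice_def using x y
      by (simp add: slope_integrable f_integrable)
    also have "\<bar>\<dots>\<bar> \<le> (\<integral>b. C * \<bar>y - x\<bar> \<partial>\<nu>)"
      using x y pt
      by (intro integral_bound_pointwise Bochner_Integration.integrable_diff integrable_divide
            slope_integrable f_integrable) auto
    finally show ?thesis by (simp add: prob_space)
  qed
  then have "\<forall>\<^sub>F y in at x within {0..}. norm ((g y - g x) / (y - x) - g' x) \<le> C * \<bar>y - x\<bar>"
    unfolding eventually_at_filter by (intro always_eventually) simp
  moreover have "((\<lambda>y. C * \<bar>y - x\<bar>) \<longlongrightarrow> C * \<bar>x - x\<bar>) (at x within {0..})"
    by (intro tendsto_intros)
  then have "((\<lambda>y. C * \<bar>y - x\<bar>) \<longlongrightarrow> 0) (at x within {0..})"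
    by simp
  ultimately have "((\<lambda>y. (g y - g x) / (y - x) - g' x) \<longlongrightarrow> 0) (at x within {0..})"
    by (rule Lim_null_comparison)
  then show ?thesis unfolding has_field_derivative_iff by (rule LIM_zero_cancel)
qed

end

section \<open>The mean-field rate and utility\<close>

locale mean_field = choice_law \<nu> \<B> f
  for \<nu> :: "'b measure" and \<B> :: "'b measure" and f :: "'b \<Rightarrow> real \<Rightarrow> real" +
  fixes \<omega> :: "real \<Rightarrow> real" and d p \<mu> :: real
  assumes regular: "regular_allocation \<omega>" and d_pos: "0 < d" and p_pos: "0 < p"
    and rate: "balanced f \<omega> \<nu> d p \<mu>"
begin

definition "x\<^sub>0 = \<omega> (d / \<mu>)"
text \<open>Derivative of participation in the expected reward. In the payment itself, with the
  allocation frozen, the derivative is \<open>x\<^sub>0 * slope\<close>, and this is the limit of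
  the regression slope.\<close>

definition "slope = g' (p * x\<^sub>0)"

lemma \<mu>_pos: "0 < \<mu>" and \<mu>_eq: "g (p * x\<^sub>0) = \<mu>"
  using rate by (auto simp: balanced_def x\<^sub>0_def mean_choice_def)

lemma \<omega>_mono: "0 \<le> x \<Longrightarrow> x \<le> y \<Longrightarrow> \<omega> x \<le> \<omega> y"
  using regular by (auto simp: regular_allocation_def mono_on_def)

lemma \<omega>_nonneg: "0 \<le> x \<Longrightarrow> 0 \<le> \<omega> x"
  using regular by (auto simp: regular_allocation_def)

lemma \<omega>_deriv: "0 \<le> x \<Longrightarrow> (\<omega> has_real_derivative hderiv \<omega> x) (at x within {0..})"
  using regular by (intro hderiv_works) (auto simp: regular_allocation_def smooth_half_def dest: spec[of _ 0])

lemma \<omega>_slope_deriv: "0 \<le> x \<Longrightarrow> (hderiv \<omega> has_real_derivative hderiv (hderiv \<omega>) x) (at x within {0..})"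
  using regular by (intro hderiv_works) (auto simp: regular_allocation_def smooth_half_def dest: spec[of _ 1])

lemma \<omega>_slope_nonneg: "0 \<le> x \<Longrightarrow> 0 \<le> hderiv \<omega> x"
  using regular nonneg_derivative_half_line[OF \<omega>_deriv] by (auto simp: regular_allocation_def)

text \<open>For \<open>y\<close> beyond \<open>x\<close>, concavity on the chord from
  \<open>0\<close> to \<open>y\<close> gives \<open>(x / y) * \<omega> y \<le> \<omega> x\<close>;
  below \<open>x\<close> monotonicity is enough. This serves the degenerate market in which the
  mean-field allocation is \<open>0\<close>.\<close>

lemma \<omega>_eq_0:
  assumes "0 < x" "\<omega> x = 0" "0 \<le> y"
  shows "\<omega> y = 0"
proof (cases "y \<le> x")
  case True
  then show ?thesis using \<omega>_mono[of y x] \<omega>_nonneg[of y] assms by simp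
next
  case False
  have "concave_on {0..} \<omega>" using regular by (simp add: regular_allocation_def)
  then have "(1 - x / y) * \<omega> 0 + (x / y) * \<omega> y \<le> \<omega> ((1 - x / y) *\<^sub>R 0 + (x / y) *\<^sub>R y)"
    using False assms by (intro concave_onD) auto
  moreover have "0 \<le> (1 - x / y) * \<omega> 0"
    using False assms \<omega>_nonneg[of 0] by (intro mult_nonneg_nonneg) auto
  ultimately have "(x / y) * \<omega> y \<le> 0" using False assms by simp
  then show ?thesis using \<omega>_nonneg[OF assms(3)] False assms(1)
    by (auto simp: mult_le_0_iff divide_le_0_iff)
qed

lemma x\<^sub>0_nonneg: "0 \<le> x\<^sub>0"
  unfolding x\<^sub>0_def using d_pos \<mu>_pos by (intro \<omega>_nonneg) auto

lemma g_continuous: "continuous_on {0..} g"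
  using mean_deriv DERIV_continuous by (fastforce simp: continuous_on_eq_continuous_within)

text \<open>Truncation at \<open>0\<close> extends \<open>g\<close> continuously to the whole line,
  so limits can be taken before the sign of the argument is known.\<close>

lemma g_max_continuous: "isCont (\<lambda>y. g (max 0 y)) x"
proof -
  have "continuous_on UNIV (\<lambda>y. g (max 0 y))"
    by (rule continuous_on_compose2[OF g_continuous]) (auto intro!: continuous_intros)
  then show ?thesis by (simp add: continuous_on_eq_continuous_at)
qed

lemma g_le: "0 \<le> x \<Longrightarrow> x \<le> y \<Longrightarrow> g x \<le> g y"
  using mean_mono by (auto simp: mono_on_def)

lemma slope_nonneg: "0 \<le> slope"
  unfolding slope_def
  by (rule nonneg_derivative_half_line[OF mean_deriv mean_mono]) (use p_pos x\<^sub>0_nonneg in auto)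

lemma \<omega>_isCont: "0 < x \<Longrightarrow> isCont \<omega> x"
  using DERIV_interior_half_line[OF \<omega>_deriv] DERIV_isCont by force

lemma \<omega>_slope_isCont: "0 < x \<Longrightarrow> isCont (hderiv \<omega>) x"
  using DERIV_interior_half_line[OF \<omega>_slope_deriv] DERIV_isCont by force

text \<open>Negative feedback of crowding: a larger rate lowers demand per supplier, hence the
  reward. Uniqueness of the balanced rate and its stability both rest on this.\<close>

lemma best_response_antimono:
  assumes "0 \<le> p'" "0 < m" "m \<le> m'"
  shows "g (p' * \<omega> (d / m')) \<le> g (p' * \<omega> (d / m))"
  using assms d_pos
  by (intro g_le mult_nonneg_nonneg mult_left_mono \<omega>_mono \<omega>_nonneg) (auto simp: frac_le)

lemma balanced_iff: "balanced f \<omega> \<nu> d p' m \<longleftrightarrow> 0 < m \<and> m = g (p' * \<omega> (d / m))"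
  by (auto simp: balanced_def mean_choice_def)

text \<open>Of two balanced rates the larger would have the smaller best response, yet each equals
  its own. The derivative at \<open>p\<close> involves rates at nearby payments, so the argument is
  made for every nonnegative \<open>p'\<close>.\<close>

lemma mf_rate_eq:
  assumes "0 \<le> p'" "balanced f \<omega> \<nu> d p' m"
  shows "mf_rate f \<omega> \<nu> d p' = m"
  unfolding mf_rate_def
proof (rule the_equality)
  show "m' = m" if "balanced f \<omega> \<nu> d p' m'" for m'
    using that assms best_response_antimono[of p' m m'] best_response_antimono[of p' m' m]
    unfolding balanced_iff by linarith
qed (rule assms)

text \<open>At payment \<open>p\<close> the gap \<open>m - g (p * \<omega> (d / m))\<close> is
  negative at \<open>\<mu> - \<delta>\<close> and positive at \<open>\<mu> + \<delta>\<close>.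
  Strict signs persist for payments near \<open>p\<close>, and the intermediate value theorem yields
  a balanced rate between. Existence near \<open>p\<close> and continuity at \<open>p\<close> come
  together.\<close>

lemma mf_rate_near:
  assumes \<delta>: "0 < \<delta>" "\<delta> < \<mu>"
  shows "\<forall>\<^sub>F p' in nhds p. balanced f \<omega> \<nu> d p' (mf_rate f \<omega> \<nu> d p') \<and> \<bar>mf_rate f \<omega> \<nu> d p' - \<mu>\<bar> < \<delta>"
proof -
  have lim: "((\<lambda>p'. g (max 0 (p' * c))) \<longlongrightarrow> g (max 0 (p * c))) (nhds p)" for c
    by (intro isCont_tendsto_compose[OF g_max_continuous] tendsto_mult_right filterlim_ident)
  have nn: "0 \<le> \<omega> (d / (\<mu> - \<delta>))" "0 \<le> \<omega> (d / (\<mu> + \<delta>))"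
    using \<delta> d_pos \<mu>_pos by (auto intro!: \<omega>_nonneg)
  have "\<mu> - \<delta> < g (p * \<omega> (d / (\<mu> - \<delta>)))" "g (p * \<omega> (d / (\<mu> + \<delta>))) < \<mu> + \<delta>"
    using best_response_antimono[of p "\<mu> - \<delta>" \<mu>] best_response_antimono[of p \<mu> "\<mu> + \<delta>"] \<delta> p_pos \<mu>_eq
    by (auto simp: x\<^sub>0_def)
  then have "\<forall>\<^sub>F p' in nhds p. \<mu> - \<delta> < g (max 0 (p' * \<omega> (d / (\<mu> - \<delta>))))"
    "\<forall>\<^sub>F p' in nhds p. g (max 0 (p' * \<omega> (d / (\<mu> + \<delta>)))) < \<mu> + \<delta>"
    using p_pos nn by (intro order_tendstoD[OF lim]; simp add: max_def)+
  moreover have "\<forall>\<^sub>F p' in nhds p. 0 < p'"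
    using p_pos eventually_gt_at_top by (intro order_tendstoD[OF filterlim_ident])
  ultimately show ?thesis
  proof eventually_elim
    case (elim p')
    have "continuous_on {\<mu> - \<delta>..\<mu> + \<delta>} (\<lambda>m. m - g (max 0 (p' * \<omega> (d / m))))"
      using \<delta> d_pos
      by (intro continuous_at_imp_continuous_on ballI continuous_diff continuous_ident
            isCont_o2[OF _ g_max_continuous] continuous_mult continuous_const
            isCont_o2[OF _ \<omega>_isCont] continuous_divide) auto
    then obtain m where m: "\<mu> - \<delta> \<le> m" "m \<le> \<mu> + \<delta>" "m - g (max 0 (p' * \<omega> (d / m))) = 0"
      using IVT'[of "\<lambda>m. m - g (max 0 (p' * \<omega> (d / m)))" "\<mu> - \<delta>" 0 "\<mu> + \<delta>"] elim \<delta> by auto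
    have "0 \<le> \<omega> (d / m)" using m \<delta> d_pos by (intro \<omega>_nonneg) auto
    then have bal: "balanced f \<omega> \<nu> d p' m"
      using m \<delta> elim by (simp add: balanced_iff max_def)
    moreover have "m \<noteq> \<mu> - \<delta>" "m \<noteq> \<mu> + \<delta>" using m elim by auto
    ultimately show ?case
      using mf_rate_eq[OF _ bal] elim m by auto
  qed
qed

lemma mf_rate_tendsto: "(mf_rate f \<omega> \<nu> d \<longlongrightarrow> \<mu>) (nhds p)"
proof (rule tendstoI)
  fix e :: real assume "0 < e"
  then have "0 < min e (\<mu> / 2)" "min e (\<mu> / 2) < \<mu>"
    using \<mu>_pos by (auto simp: min_def)
  from mf_rate_near[OF this] show "\<forall>\<^sub>F p' in nhds p. dist (mf_rate f \<omega> \<nu> d p') \<mu> < e"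
    by (rule eventually_mono) (auto simp: dist_real_def)
qed

lemma mf_rate_p: "mf_rate f \<omega> \<nu> d p = \<mu>"
  using mf_rate_eq[OF _ rate] p_pos by simp

lemma allocation_of_rate_deriv:
  "((\<lambda>m. \<omega> (d / m)) has_real_derivative - hderiv \<omega> (d / \<mu>) * d / \<mu>\<^sup>2) (at \<mu>)"
proof -
  have "((\<lambda>m. d / m) has_real_derivative - d / \<mu>\<^sup>2) (at \<mu>)"
    using \<mu>_pos by (auto intro!: derivative_eq_intros simp: power2_eq_square)
  from DERIV_chain2[OF DERIV_interior_half_line[OF \<omega>_deriv] this] show ?thesis
    using d_pos \<mu>_pos by simp
qed

text \<open>Caratheodory's form of the derivative turns the balance equation into a linear equation for
  the difference quotient of the rate, and no implicit function theorem is needed.\<close>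

lemma mf_rate_deriv:
  "(mf_rate f \<omega> \<nu> d has_real_derivative
     slope * x\<^sub>0 / (1 + p * d * slope * hderiv \<omega> (d / \<mu>) / \<mu>\<^sup>2)) (at p)"
proof -
  define y0 where "y0 = p * x\<^sub>0"
  \<comment> \<open>\<open>k\<close> and \<open>w\<close> are difference quotients filled in at the
    base point by the derivative, hence continuous there (\<open>k\<close> within the half-line).
    They turn increments into exact products, also where an increment vanishes.\<close>
  define k where "k y = (if y = y0 then slope else (g y - g y0) / (y - y0))" for y
  define w where "w m = (if m = \<mu> then - hderiv \<omega> (d / \<mu>) * d / \<mu>\<^sup>2
    else (\<omega> (d / m) - \<omega> (d / \<mu>)) / (m - \<mu>))" for m
  define m where "m = mf_rate f \<omega> \<nu> d"
  define y where "y p' = p' * \<omega> (d / m p')" for p'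
  have y0: "0 \<le> y0" unfolding y0_def using p_pos x\<^sub>0_nonneg by simp
  have m_lim: "(m \<longlongrightarrow> \<mu>) (at p)"
    unfolding m_def by (rule tendsto_mono[OF at_within_le_nhds mf_rate_tendsto])
  have k_cont: "(k \<longlongrightarrow> slope) (at y0 within {0..})"
  proof -
    have "((\<lambda>y. (g y - g y0) / (y - y0)) \<longlongrightarrow> slope) (at y0 within {0..})"
      using mean_deriv[OF y0] by (simp add: has_field_derivative_iff slope_def y0_def)
    then show ?thesis
      by (rule Lim_transform_eventually) (auto simp: eventually_at_filter k_def)
  qed
  have w_cont: "(w \<longlongrightarrow> - hderiv \<omega> (d / \<mu>) * d / \<mu>\<^sup>2) (at \<mu>)"
  proof -
    have "((\<lambda>m. (\<omega> (d / m) - \<omega> (d / \<mu>)) / (m - \<mu>)) \<longlongrightarrow> - hderiv \<omega> (d / \<mu>) * d / \<mu>\<^sup>2) (at \<mu>)"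
      using allocation_of_rate_deriv by (simp add: has_field_derivative_iff)
    then show ?thesis
      by (rule Lim_transform_eventually) (auto simp: eventually_at_filter w_def)
  qed
  have near: "\<forall>\<^sub>F p' in at p. balanced f \<omega> \<nu> d p' (m p')"
    using mf_rate_near[of "\<mu> / 2"] \<mu>_pos unfolding m_def
    by (auto simp: eventually_at_filter elim: eventually_mono)
  have pos: "\<forall>\<^sub>F p' in at p. 0 < p'"
    using p_pos by (intro order_tendstoD[OF tendsto_ident_at])
  have w_lim: "((\<lambda>p'. w (m p')) \<longlongrightarrow> - hderiv \<omega> (d / \<mu>) * d / \<mu>\<^sup>2) (at p)"
  proof -
    have "isCont w \<mu>" using w_cont by (simp add: isCont_def w_def)
    from isCont_tendsto_compose[OF this m_lim] show ?thesis by (simp add: w_def)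
  qed
  have y_lim: "(y \<longlongrightarrow> y0) (at p)"
    unfolding y_def y0_def x\<^sub>0_def
    using d_pos \<mu>_pos by (intro tendsto_intros isCont_tendsto_compose[OF \<omega>_isCont] m_lim) auto
  have k_lim: "((\<lambda>p'. k (y p')) \<longlongrightarrow> slope) (at p)"
  proof -
    have "continuous (at y0 within {0..}) k"
      using k_cont by (simp add: continuous_within k_def)
    moreover have "\<forall>\<^sub>F p' in at p. y p' \<in> {0..}"
      using near pos
    proof eventually_elim
      case (elim p')
      then show ?case using d_pos by (auto simp: y_def balanced_iff intro!: mult_nonneg_nonneg \<omega>_nonneg)
    qed
    ultimately show ?thesis
      using continuous_within_tendsto_compose[of y0 "{0..}" k y "at p"] y_lim by (simp add: k_def)
  qed
  have quotient: "\<forall>\<^sub>F p' in at p. k (y p') * x\<^sub>0 / (1 - k (y p') * p' * w (m p')) = (m p' - m p) / (p' - p)"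
    using near pos eventually_neq_at_within[of p p UNIV]
  proof eventually_elim
    case (elim p')
    let ?m = "m p'"
    have m: "0 < ?m" "?m = g (y p')" using elim by (auto simp: balanced_iff y_def)
    have y: "0 \<le> y p'" using m(1) d_pos elim by (auto simp: y_def intro!: mult_nonneg_nonneg \<omega>_nonneg)
    have k: "g (y p') - g y0 = k (y p') * (y p' - y0)" by (simp add: k_def)
    have w: "\<omega> (d / ?m) - \<omega> (d / \<mu>) = w ?m * (?m - \<mu>)" by (simp add: w_def)
    \<comment> \<open>Monotonicity fixes the signs of \<open>k\<close> and \<open>w\<close>, so the
      denominator below is at least \<open>1\<close> and the division is legitimate at each
      \<open>p'\<close> near \<open>p\<close>, not only in the limit.\<close>
    have "0 \<le> k (y p')"
      using slope_nonneg g_le[of y0 "y p'"] g_le[of "y p'" y0] y y0 linear[of y0 "y p'"]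
      by (auto simp: k_def divide_le_0_iff zero_le_divide_iff)
    moreover have "w ?m \<le> 0"
    proof -
      have "\<omega> (d / ?m) \<le> \<omega> (d / \<mu>)" if "\<mu> \<le> ?m"
        using that m(1) d_pos \<mu>_pos by (intro \<omega>_mono) (auto simp: frac_le)
      moreover have "\<omega> (d / \<mu>) \<le> \<omega> (d / ?m)" if "?m \<le> \<mu>"
        using that m(1) d_pos \<mu>_pos by (intro \<omega>_mono) (auto simp: frac_le)
      ultimately show ?thesis
        using \<omega>_slope_nonneg[of "d / \<mu>"] d_pos \<mu>_pos linear[of \<mu> ?m]
        by (auto simp: w_def divide_le_0_iff intro!: mult_nonneg_nonneg)
    qed
    ultimately have "0 \<le> k (y p') * p' * (- w ?m)"
      using elim by (intro mult_nonneg_nonneg) auto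
    then have den: "0 < 1 - k (y p') * p' * w ?m" by simp
    have "?m - \<mu> = k (y p') * (y p' - y0)" using k m(2) \<mu>_eq by (metis y0_def)
    \<comment> \<open>Direct effect of the payment plus its indirect effect through the allocation;
      the second is proportional to the increment of the rate and moves to the left-hand
      side.\<close>
    also have "y p' - y0 = (p' - p) * x\<^sub>0 + p' * (\<omega> (d / ?m) - \<omega> (d / \<mu>))"
      by (simp add: y_def y0_def x\<^sub>0_def algebra_simps)
    finally have "(?m - \<mu>) * (1 - k (y p') * p' * w ?m) = k (y p') * x\<^sub>0 * (p' - p)"
      unfolding w by (simp add: algebra_simps)
    moreover have "m p = \<mu>" by (simp add: m_def mf_rate_p)
    ultimately show ?case using den elim by (simp add: frac_eq_eq)
  qed
  have "1 - slope * p * (- hderiv \<omega> (d / \<mu>) * d / \<mu>\<^sup>2) \<noteq> 0"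
  proof -
    have "0 \<le> slope * p * (hderiv \<omega> (d / \<mu>) * d / \<mu>\<^sup>2)"
      using slope_nonneg p_pos d_pos \<mu>_pos \<omega>_slope_nonneg[of "d / \<mu>"] by simp
    then show ?thesis by simp
  qed
  then have "((\<lambda>p'. k (y p') * x\<^sub>0 / (1 - k (y p') * p' * w (m p'))) \<longlongrightarrow>
      slope * x\<^sub>0 / (1 - slope * p * (- hderiv \<omega> (d / \<mu>) * d / \<mu>\<^sup>2))) (at p)"
    by (intro tendsto_intros k_lim w_lim)
  from Lim_transform_eventually[OF this quotient]
  show ?thesis unfolding has_field_derivative_iff m_def by (simp add: mult_ac)
qed

end

section \<open>Stability of the equilibrium and the limit of the participation gradient\<close>

context mean_field
begin

text \<open>Changing demand and rate by the same proportion leaves their ratio fixed. Thus the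
  demand tolerance \<open>d * \<delta> / \<mu>\<close> exactly offsets a shift of the rate by
  \<open>\<delta>\<close>, and bounds on the allocation can be expressed by \<open>x\<^sub>0\<close>
  itself.\<close>

lemma balanced_allocation:
  assumes "0 < \<delta>" "\<delta> < \<mu>"
  shows "(d - d * \<delta> / \<mu>) / (\<mu> - \<delta>) = d / \<mu>" "(d + d * \<delta> / \<mu>) / (\<mu> + \<delta>) = d / \<mu>"
    "0 < d * \<delta> / \<mu>" "d * \<delta> / \<mu> < d"
proof -
  have "d - d * \<delta> / \<mu> = d / \<mu> * (\<mu> - \<delta>)" "d + d * \<delta> / \<mu> = d / \<mu> * (\<mu> + \<delta>)"
    using \<mu>_pos by (simp_all add: field_simps)
  then show "(d - d * \<delta> / \<mu>) / (\<mu> - \<delta>) = d / \<mu>" "(d + d * \<delta> / \<mu>) / (\<mu> + \<delta>) = d / \<mu>"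
    using assms \<mu>_pos by simp_all
qed (use assms \<mu>_pos d_pos in \<open>auto simp: pos_divide_less_eq\<close>)

text \<open>Continuity of \<open>g\<close> at the balanced reward \<open>p * x\<^sub>0\<close>, with
  one margin \<open>e\<close> for payment and allocation alike. The truncation covers
  \<open>x\<^sub>0 < e\<close>, in particular \<open>x\<^sub>0 = 0\<close>.\<close>

lemma response_margin:
  assumes "0 < \<delta>"
  obtains e where "0 < e" "e < p" "\<mu> - \<delta> < g ((p - e) * max 0 (x\<^sub>0 - e))" "g ((p + e) * (x\<^sub>0 + e)) < \<mu> + \<delta>"
proof -
  have "((\<lambda>e. g (max 0 ((p - e) * max 0 (x\<^sub>0 - e)))) \<longlongrightarrow> g (max 0 ((p - 0) * max 0 (x\<^sub>0 - 0)))) (at_right 0)"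
    by (intro isCont_tendsto_compose[OF g_max_continuous] tendsto_intros)
  then have "\<forall>\<^sub>F e in at_right 0. \<mu> - \<delta> < g (max 0 ((p - e) * max 0 (x\<^sub>0 - e)))"
    by (rule order_tendstoD) (use \<mu>_eq x\<^sub>0_nonneg p_pos assms in \<open>simp add: max_def\<close>)
  moreover have "((\<lambda>e. g (max 0 ((p + e) * (x\<^sub>0 + e)))) \<longlongrightarrow> g (max 0 ((p + 0) * (x\<^sub>0 + 0)))) (at_right 0)"
    by (intro isCont_tendsto_compose[OF g_max_continuous] tendsto_intros)
  then have "\<forall>\<^sub>F e in at_right 0. g (max 0 ((p + e) * (x\<^sub>0 + e))) < \<mu> + \<delta>"
    by (rule order_tendstoD) (use \<mu>_eq x\<^sub>0_nonneg p_pos assms in \<open>simp add: max_def\<close>)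
  moreover have "\<forall>\<^sub>F e in at_right 0. e \<in> {0<..<p}"
    using p_pos by (rule eventually_at_right_real)
  ultimately have "\<forall>\<^sub>F e in at_right 0. 0 < e \<and> e < p \<and> \<mu> - \<delta> < g ((p - e) * max 0 (x\<^sub>0 - e)) \<and>
      g ((p + e) * (x\<^sub>0 + e)) < \<mu> + \<delta>"
  proof eventually_elim
    case (elim e)
    then have "0 \<le> (p - e) * max 0 (x\<^sub>0 - e)" "0 \<le> (p + e) * (x\<^sub>0 + e)"
      using x\<^sub>0_nonneg p_pos by auto
    then show ?case using elim by (simp add: max_absorb2)
  qed
  then show ?thesis using that eventually_happens[of _ "at_right (0::real)"] by auto
qed

definition rate_at :: "real \<Rightarrow> real \<Rightarrow> real" where
  "rate_at z x = (g ((p + z) * x) + g ((p - z) * x)) / 2"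

text \<open>\<open>lower\<close> and \<open>upper\<close> express the feedback as implications under
  the eventuality. They are used at a given \<open>n\<close> only if the rate strays there, so the
  contradiction arises separately for each large \<open>n\<close> and no subsequence has to be
  extracted.\<close>

lemma equilibrium_limit:
  fixes z X :: "nat \<Rightarrow> real"
  assumes z: "z \<longlonglongrightarrow> 0" "\<And>n. 0 \<le> z n" and X: "\<And>n. 0 \<le> X n"
    and lower: "\<And>m \<eta> \<delta> e. 0 < m \<Longrightarrow> 0 < \<eta> \<Longrightarrow> \<eta> < d \<Longrightarrow> 0 < \<delta> \<Longrightarrow> 0 < e \<Longrightarrow>
      \<forall>\<^sub>F n in sequentially. rate_at (z n) (X n) + \<delta> \<le> m \<longrightarrow> \<omega> ((d - \<eta>) / m) - e \<le> X n"
    and upper: "\<And>m \<eta> \<delta> e. 0 < m \<Longrightarrow> 0 < \<eta> \<Longrightarrow> \<eta> < d \<Longrightarrow> 0 < \<delta> \<Longrightarrow> 0 < e \<Longrightarrow>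
      \<forall>\<^sub>F n in sequentially. m \<le> rate_at (z n) (X n) - \<delta> \<longrightarrow> X n \<le> \<omega> ((d + \<eta>) / m) + e"
  shows "(\<lambda>n. rate_at (z n) (X n)) \<longlonglongrightarrow> \<mu>" "X \<longlonglongrightarrow> x\<^sub>0"
proof -
  let ?q = "\<lambda>n. rate_at (z n) (X n)"
  have small_z: "\<forall>\<^sub>F n in sequentially. z n < e" if "0 < e" for e
    using z(1) that by (rule order_tendstoD)
  have q: "\<forall>\<^sub>F n in sequentially. \<mu> - \<delta> < ?q n \<and> ?q n < \<mu> + \<delta>" if \<delta>: "0 < \<delta>" "\<delta> < \<mu>" for \<delta>
  proof -
    obtain e where e: "0 < e" "e < p" "\<mu> - \<delta> < g ((p - e) * max 0 (x\<^sub>0 - e))"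
      "g ((p + e) * (x\<^sub>0 + e)) < \<mu> + \<delta>" using response_margin \<delta>(1) by blast
    have h: "0 < \<delta> / 2" "\<delta> / 2 < \<mu>" using \<delta> by auto
    note bal = balanced_allocation[OF h]
    \<comment> \<open>Half of \<open>\<delta>\<close> shifts the rate and the other half is the
      slack that \<open>lower\<close> demands; the matching demand tolerance makes the bound
      \<open>x\<^sub>0 - e\<close>.\<close>
    have "\<forall>\<^sub>F n in sequentially. ?q n + \<delta> / 2 \<le> \<mu> - \<delta> / 2 \<longrightarrow> x\<^sub>0 - e \<le> X n"
      using lower[OF _ bal(3,4) h(1) e(1), of "\<mu> - \<delta> / 2"] h unfolding bal x\<^sub>0_def by simp
    moreover have "\<forall>\<^sub>F n in sequentially. \<mu> + \<delta> / 2 \<le> ?q n - \<delta> / 2 \<longrightarrow> X n \<le> x\<^sub>0 + e"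
      using upper[OF _ bal(3,4) h(1) e(1), of "\<mu> + \<delta> / 2"] h \<mu>_pos unfolding bal x\<^sub>0_def by simp
    ultimately show ?thesis using small_z[OF e(1)]
    proof eventually_elim
      case (elim n)
      have "\<mu> - \<delta> < ?q n"
      proof (rule ccontr)
        assume c: "\<not> ?thesis"
        then have "x\<^sub>0 - e \<le> X n" using elim by auto
        \<comment> \<open>Even the smaller payment offers enough to push participation above
          \<open>\<mu> - \<delta>\<close>; the larger one offers no less, so the average of the two
          exceeds it as well.\<close>
        then have "(p - e) * max 0 (x\<^sub>0 - e) \<le> (p - z n) * X n"
          using elim e X[of n] by (intro mult_mono) auto
        moreover have "0 \<le> (p - e) * max 0 (x\<^sub>0 - e)" using e by auto
        moreover have "(p - z n) * X n \<le> (p + z n) * X n" using z(2)[of n] X[of n] by (intro mult_right_mono) auto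
        ultimately have "g ((p - e) * max 0 (x\<^sub>0 - e)) \<le> g ((p - z n) * X n)"
          "g ((p - z n) * X n) \<le> g ((p + z n) * X n)" by (auto intro!: g_le)
        then show False using c e(3) by (simp add: rate_at_def)
      qed
      moreover have "?q n < \<mu> + \<delta>"
      proof (rule ccontr)
        assume c: "\<not> ?thesis"
        then have "X n \<le> x\<^sub>0 + e" using elim by auto
        then have "(p + z n) * X n \<le> (p + e) * (x\<^sub>0 + e)"
          using elim e z(2)[of n] X[of n] x\<^sub>0_nonneg p_pos by (intro mult_mono) auto
        moreover have "0 \<le> (p - z n) * X n" using elim e X[of n] by auto
        moreover have "(p - z n) * X n \<le> (p + z n) * X n" using z(2)[of n] X[of n] by (intro mult_right_mono) auto
        ultimately have "g ((p + z n) * X n) \<le> g ((p + e) * (x\<^sub>0 + e))"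
          "g ((p - z n) * X n) \<le> g ((p + z n) * X n)" by (auto intro!: g_le)
        then show False using c e(4) by (simp add: rate_at_def)
      qed
      ultimately show ?case by simp
    qed
  qed
  show "?q \<longlonglongrightarrow> \<mu>"
  proof (rule tendstoI)
    fix e :: real assume "0 < e"
    then have "0 < min e (\<mu> / 2)" "min e (\<mu> / 2) < \<mu>" using \<mu>_pos by (auto simp: min_def)
    from q[OF this] show "\<forall>\<^sub>F n in sequentially. dist (?q n) \<mu> < e"
      by (rule eventually_mono) (auto simp: dist_real_def)
  qed
  show "X \<longlonglongrightarrow> x\<^sub>0"
  proof (rule tendstoI)
    fix e :: real assume e: "0 < e"
    \<comment> \<open>Since the rate is eventually within \<open>\<delta>\<close> of
      \<open>\<mu>\<close>, the choices \<open>m = \<mu> + 2 * \<delta>\<close> and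
      \<open>m = \<mu> - 2 * \<delta>\<close> meet the premises of \<open>lower\<close> and
      \<open>upper\<close> with slack \<open>\<delta>\<close>. Continuity of \<open>\<omega>\<close>
      brings both resulting bounds close to \<open>x\<^sub>0\<close> for small
      \<open>\<delta>\<close>.\<close>
    have "((\<lambda>\<delta>. \<omega> ((d - \<delta>) / (\<mu> + 2 * \<delta>))) \<longlongrightarrow> \<omega> ((d - 0) / (\<mu> + 2 * 0))) (at_right 0)"
      using d_pos \<mu>_pos by (intro isCont_tendsto_compose[OF \<omega>_isCont] tendsto_intros) auto
    then have "\<forall>\<^sub>F \<delta> in at_right 0. x\<^sub>0 - e / 2 < \<omega> ((d - \<delta>) / (\<mu> + 2 * \<delta>))"
      by (rule order_tendstoD) (use e in \<open>simp add: x\<^sub>0_def\<close>)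
    moreover have "((\<lambda>\<delta>. \<omega> ((d + \<delta>) / (\<mu> - 2 * \<delta>))) \<longlongrightarrow> \<omega> ((d + 0) / (\<mu> - 2 * 0))) (at_right 0)"
      using d_pos \<mu>_pos by (intro isCont_tendsto_compose[OF \<omega>_isCont] tendsto_intros) auto
    then have "\<forall>\<^sub>F \<delta> in at_right 0. \<omega> ((d + \<delta>) / (\<mu> - 2 * \<delta>)) < x\<^sub>0 + e / 2"
      by (rule order_tendstoD) (use e in \<open>simp add: x\<^sub>0_def\<close>)
    moreover have "0 < min d (\<mu> / 2)" using d_pos \<mu>_pos by auto
    then have "\<forall>\<^sub>F \<delta> in at_right 0. \<delta> \<in> {0<..<min d (\<mu> / 2)}"
      by (rule eventually_at_right_real)
    ultimately have "\<forall>\<^sub>F \<delta> in at_right 0. x\<^sub>0 - e / 2 < \<omega> ((d - \<delta>) / (\<mu> + 2 * \<delta>)) \<and>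
        \<omega> ((d + \<delta>) / (\<mu> - 2 * \<delta>)) < x\<^sub>0 + e / 2 \<and> \<delta> \<in> {0<..<min d (\<mu> / 2)}"
      by eventually_elim auto
    then obtain \<delta> where \<delta>: "x\<^sub>0 - e / 2 < \<omega> ((d - \<delta>) / (\<mu> + 2 * \<delta>))"
        "\<omega> ((d + \<delta>) / (\<mu> - 2 * \<delta>)) < x\<^sub>0 + e / 2" "0 < \<delta>" "\<delta> < d" "\<delta> < \<mu> / 2"
      using eventually_happens[of _ "at_right (0::real)"] by auto
    have "\<forall>\<^sub>F n in sequentially. ?q n + \<delta> \<le> \<mu> + 2 * \<delta> \<longrightarrow> \<omega> ((d - \<delta>) / (\<mu> + 2 * \<delta>)) - e / 2 \<le> X n"
      using \<delta> e \<mu>_pos by (intro lower) auto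
    moreover have "\<forall>\<^sub>F n in sequentially. \<mu> - 2 * \<delta> \<le> ?q n - \<delta> \<longrightarrow> X n \<le> \<omega> ((d + \<delta>) / (\<mu> - 2 * \<delta>)) + e / 2"
      using \<delta> e \<mu>_pos by (intro upper) auto
    moreover have "\<forall>\<^sub>F n in sequentially. \<mu> - \<delta> < ?q n \<and> ?q n < \<mu> + \<delta>"
      using \<delta> by (intro q) auto
    ultimately show "\<forall>\<^sub>F n in sequentially. dist (X n) x\<^sub>0 < e"
    proof eventually_elim
      case (elim n)
      then show ?case using \<delta> by (auto simp: dist_real_def)
    qed
  qed
qed

text \<open>The intermediate points \<open>\<xi>\<close> of the mean value theorem are squeezed
  between two sequences tending to \<open>p * x\<^sub>0\<close>, and \<open>g'\<close> is continuous
  there. Where \<open>X n = 0\<close> the quotient vanishes and \<open>\<xi> = 0\<close>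
  serves.\<close>

lemma slope_limit:
  fixes z X :: "nat \<Rightarrow> real"
  assumes z: "z \<longlonglongrightarrow> 0" "\<forall>\<^sub>F n in sequentially. 0 < z n \<and> z n < p" and X: "\<And>n. 0 \<le> X n" "X \<longlonglongrightarrow> x\<^sub>0"
  shows "(\<lambda>n. (g ((p + z n) * X n) - g ((p - z n) * X n)) / 2 / z n) \<longlonglongrightarrow> x\<^sub>0 * slope"
proof -
  have "\<exists>\<xi>. 0 < z n \<and> z n < p \<longrightarrow> (p - z n) * X n \<le> \<xi> \<and> \<xi> \<le> (p + z n) * X n \<and>
      (g ((p + z n) * X n) - g ((p - z n) * X n)) / 2 / z n = X n * g' \<xi>" for n
  proof (cases "0 < z n \<and> z n < p \<and> 0 < X n")
    case True
    then have "0 \<le> (p - z n) * X n" "(p - z n) * X n < (p + z n) * X n"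
      by (auto intro!: mult_strict_right_mono)
    then obtain \<xi> where \<xi>: "(p - z n) * X n < \<xi>" "\<xi> < (p + z n) * X n"
      "g ((p + z n) * X n) - g ((p - z n) * X n) = ((p + z n) * X n - (p - z n) * X n) * g' \<xi>"
      using MVT_half_line[OF mean_deriv] by metis
    then show ?thesis using True by (intro exI[of _ \<xi>]) (auto simp: field_simps)
  next
    case False
    then show ?thesis using X(1)[of n] by (intro exI[of _ 0]) auto
  qed
  then obtain \<xi> where \<xi>: "\<And>n. 0 < z n \<and> z n < p \<Longrightarrow> (p - z n) * X n \<le> \<xi> n \<and> \<xi> n \<le> (p + z n) * X n \<and>
      (g ((p + z n) * X n) - g ((p - z n) * X n)) / 2 / z n = X n * g' (\<xi> n)" by metis
  have "(\<lambda>n. (p - z n) * X n) \<longlonglongrightarrow> (p - 0) * x\<^sub>0" "(\<lambda>n. (p + z n) * X n) \<longlonglongrightarrow> (p + 0) * x\<^sub>0"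
    by (intro tendsto_intros z X)+
  then have \<xi>_lim: "\<xi> \<longlonglongrightarrow> p * x\<^sub>0"
    by (intro tendsto_sandwich[of "\<lambda>n. (p - z n) * X n" \<xi> sequentially "\<lambda>n. (p + z n) * X n"])
       (use \<xi> z(2) in \<open>auto elim: eventually_mono\<close>)
  moreover have "\<forall>\<^sub>F n in sequentially. \<xi> n \<in> {0..}"
    using z(2)
  proof eventually_elim
    case (elim n)
    have "0 \<le> (p - z n) * X n" using elim X(1)[of n] by auto
    then show ?case using \<xi>[OF elim] by auto
  qed
  moreover have "continuous (at (p * x\<^sub>0) within {0..}) g'"
    using mean_slope_continuous p_pos x\<^sub>0_nonneg by (simp add: continuous_on_eq_continuous_within)
  ultimately have "(\<lambda>n. g' (\<xi> n)) \<longlonglongrightarrow> slope"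
    unfolding slope_def using continuous_within_tendsto_compose[of "p * x\<^sub>0" "{0..}" g' \<xi>] by blast
  then have "(\<lambda>n. X n * g' (\<xi> n)) \<longlonglongrightarrow> x\<^sub>0 * slope"
    by (intro tendsto_intros X)
  then show ?thesis
    by (rule Lim_transform_eventually) (use z(2) \<xi> in \<open>auto elim: eventually_mono\<close>)
qed

end

section \<open>Derivative of the mean-field utility and continuity of the estimator\<close>

locale mean_field_revenue = mean_field \<nu> \<B> f \<omega> d p \<mu>
  for \<nu> \<B> :: "'b measure" and f \<omega> d p \<mu> +
  fixes r :: "real \<Rightarrow> real"
  assumes r_smooth: "smooth_half r"
begin

lemma r_deriv: "0 \<le> x \<Longrightarrow> (r has_real_derivative hderiv r x) (at x within {0..})"
  using r_smooth by (intro hderiv_works) (auto simp: smooth_half_def dest: spec[of _ 0])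

lemma r_slope_deriv: "0 \<le> x \<Longrightarrow> (hderiv r has_real_derivative hderiv (hderiv r) x) (at x within {0..})"
  using r_smooth by (intro hderiv_works) (auto simp: smooth_half_def dest: spec[of _ 1])

lemma r_isCont: "0 < x \<Longrightarrow> isCont r x"
  using DERIV_interior_half_line[OF r_deriv] DERIV_isCont by force

lemma r_slope_isCont: "0 < x \<Longrightarrow> isCont (hderiv r) x"
  using DERIV_interior_half_line[OF r_slope_deriv] DERIV_isCont by force

lemma Upsilon_at_limit:
  "Upsilon_hat p \<omega> d \<mu> (x\<^sub>0 * slope) = slope * x\<^sub>0 / (1 + p * d * slope * hderiv \<omega> (d / \<mu>) / \<mu>\<^sup>2)"
  unfolding Upsilon_hat_def x\<^sub>0_def[symmetric] by (cases "x\<^sub>0 = 0") (simp_all add: mult_ac)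

lemma deriv_mf_utility:
  "deriv (mf_utility r f \<omega> \<nu> d) p = Gamma_hat p \<omega> r d \<mu> (x\<^sub>0 * slope)"
proof -
  let ?m = "mf_rate f \<omega> \<nu> d" and ?m' = "Upsilon_hat p \<omega> d \<mu> (x\<^sub>0 * slope)" and ?x = "d / \<mu>"
  have m: "(?m has_real_derivative ?m') (at p)"
    using mf_rate_deriv by (simp add: Upsilon_at_limit)
  have x: "0 < ?x" using d_pos \<mu>_pos by simp
  have "((\<lambda>p'. d / ?m p') has_real_derivative - d * ?m' / \<mu>\<^sup>2) (at p)"
    using \<mu>_pos by (auto intro!: derivative_eq_intros m simp: mf_rate_p power2_eq_square)
  then have q: "((\<lambda>p'. h (d / ?m p')) has_real_derivative h' * (- d * ?m' / \<mu>\<^sup>2)) (at p)"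
    if "(h has_real_derivative h') (at ?x)" for h h'
    using that by (intro DERIV_chain2[of h]) (simp_all add: mf_rate_p)
  have "((\<lambda>p'. (r (d / ?m p') - p' * \<omega> (d / ?m p')) * ?m p') has_real_derivative
      (hderiv r ?x * (- d * ?m' / \<mu>\<^sup>2) - (1 * \<omega> ?x + hderiv \<omega> ?x * (- d * ?m' / \<mu>\<^sup>2) * p)) * \<mu>
      + ?m' * (r ?x - p * \<omega> ?x)) (at p)"
    using DERIV_mult[OF DERIV_diff[OF q[OF DERIV_interior_half_line[OF r_deriv]]
          DERIV_mult[OF DERIV_ident q[OF DERIV_interior_half_line[OF \<omega>_deriv]]]] m] x
    by (simp add: mf_rate_p)
  also have "(\<lambda>p'. (r (d / ?m p') - p' * \<omega> (d / ?m p')) * ?m p') = mf_utility r f \<omega> \<nu> d"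
    by (simp add: fun_eq_iff mf_utility_def Let_def)
  finally have "deriv (mf_utility r f \<omega> \<nu> d) p =
      (hderiv r ?x * (- d * ?m' / \<mu>\<^sup>2) - (1 * \<omega> ?x + hderiv \<omega> ?x * (- d * ?m' / \<mu>\<^sup>2) * p)) * \<mu>
      + ?m' * (r ?x - p * \<omega> ?x)"
    by (rule DERIV_imp_deriv)
  moreover have "- d * ?m' / \<mu>\<^sup>2 * \<mu> = - ?m' * ?x"
    using \<mu>_pos by (simp add: power2_eq_square)
  \<comment> \<open>Values and slopes of \<open>r\<close> and \<open>\<omega>\<close> at
    \<open>d / \<mu>\<close> are generalised to letters, so that collecting the terms in
    \<open>?m'\<close> becomes a polynomial identity.\<close>
  then have "(a * (- d * ?m' / \<mu>\<^sup>2) - (1 * b + c * (- d * ?m' / \<mu>\<^sup>2) * p)) * \<mu> + ?m' * (e - p * b) =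
      ?m' * (e - p * b - (a - p * c) * ?x) - b * \<mu>" for a b c e :: real
    by algebra
  ultimately show ?thesis unfolding Gamma_hat_def by simp
qed

text \<open>If \<open>\<omega>\<close> vanishes at \<open>d / \<mu>\<close>, then by concavity it vanishes everywhere, and the convention
  \<open>x / 0 = 0\<close> turns the denominator of \<open>Upsilon_hat\<close> into \<open>1\<close>.\<close>

lemma Upsilon_tendsto:
  assumes D: "(Db \<longlongrightarrow> d) F" and Z: "(Zb \<longlongrightarrow> \<mu>) F" and \<Delta>: "(\<Delta> \<longlongrightarrow> x\<^sub>0 * slope) F"
  shows "((\<lambda>i. Upsilon_hat p \<omega> (Db i) (Zb i) (\<Delta> i)) \<longlongrightarrow> Upsilon_hat p \<omega> d \<mu> (x\<^sub>0 * slope)) F"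
proof (cases "x\<^sub>0 = 0")
  case True
  have "\<forall>\<^sub>F i in F. 0 < Db i \<and> 0 < Zb i"
    using order_tendstoD(1)[OF D d_pos] order_tendstoD(1)[OF Z \<mu>_pos] by eventually_elim simp
  then have "\<forall>\<^sub>F i in F. \<Delta> i = Upsilon_hat p \<omega> (Db i) (Zb i) (\<Delta> i)"
  proof eventually_elim
    case (elim i)
    have "\<omega> (d / \<mu>) = 0" using True by (simp add: x\<^sub>0_def)
    from \<omega>_eq_0[OF _ this, of "Db i / Zb i"] have "\<omega> (Db i / Zb i) = 0"
      using d_pos \<mu>_pos elim by simp
    then show ?case by (simp add: Upsilon_hat_def)
  qed
  moreover have "Upsilon_hat p \<omega> d \<mu> (x\<^sub>0 * slope) = x\<^sub>0 * slope"
    unfolding Upsilon_hat_def x\<^sub>0_def[symmetric] using True by simp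
  ultimately show ?thesis
    using Lim_transform_eventually[OF \<Delta>] by (simp only:)
next
  case False
  have x: "0 < d / \<mu>" using d_pos \<mu>_pos by simp
  have "0 \<le> p * d * (x\<^sub>0 * slope) * hderiv \<omega> (d / \<mu>) / (\<mu>\<^sup>2 * \<omega> (d / \<mu>))"
    using p_pos d_pos slope_nonneg x\<^sub>0_nonneg \<omega>_slope_nonneg[of "d / \<mu>"] x \<omega>_nonneg[of "d / \<mu>"]
    by (intro divide_nonneg_nonneg mult_nonneg_nonneg) auto
  then have "1 + p * d * (x\<^sub>0 * slope) * hderiv \<omega> (d / \<mu>) / (\<mu>\<^sup>2 * \<omega> (d / \<mu>)) \<noteq> 0"
    by linarith
  then show ?thesis
    unfolding Upsilon_hat_def using False \<mu>_pos x
    by (intro tendsto_intros D Z \<Delta> isCont_tendsto_compose[OF \<omega>_isCont]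
          isCont_tendsto_compose[OF \<omega>_slope_isCont]) (auto simp: x\<^sub>0_def)
qed

text \<open>The arbitrary filter allows neighbourhoods of the limit point, so the lemma can be read
  as continuity of the whole estimator; probability enters only afterwards.\<close>

lemma Gamma_tendsto:
  assumes D: "(Db \<longlongrightarrow> d) F" and Z: "(Zb \<longlongrightarrow> \<mu>) F" and \<Delta>: "(\<Delta> \<longlongrightarrow> x\<^sub>0 * slope) F"
  shows "((\<lambda>i. Gamma_hat p \<omega> r (Db i) (Zb i) (\<Delta> i)) \<longlongrightarrow> deriv (mf_utility r f \<omega> \<nu> d) p) F"
  unfolding deriv_mf_utility unfolding Gamma_hat_def using d_pos \<mu>_pos
  by (intro tendsto_intros Upsilon_tendsto D Z \<Delta> isCont_tendsto_compose[OF \<omega>_isCont]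
        isCont_tendsto_compose[OF \<omega>_slope_isCont] isCont_tendsto_compose[OF r_isCont]
        isCont_tendsto_compose[OF r_slope_isCont]) auto

end

section \<open>Concentration in one market\<close>

text \<open>Chebyshev's inequality asks for means and pairwise products only, which are the moments
  that one- and two-element index sets provide. Variables bounded by \<open>1\<close> give the
  average a variance of at most \<open>1 / n\<close>.\<close>

lemma (in prob_space) weak_law_bound:
  fixes W :: "nat \<Rightarrow> 'a \<Rightarrow> real"
  assumes n: "0 < n" and \<delta>: "0 < \<delta>"
    and W: "\<And>i. i < n \<Longrightarrow> W i \<in> borel_measurable M"
    and bounded: "\<And>i w. i < n \<Longrightarrow> w \<in> space M \<Longrightarrow> \<bar>W i w\<bar> \<le> 1"
    and mean: "\<And>i. i < n \<Longrightarrow> expectation (W i) = e"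
    and uncorrelated: "\<And>i j. i < n \<Longrightarrow> j < n \<Longrightarrow> i \<noteq> j \<Longrightarrow> expectation (\<lambda>w. W i w * W j w) = e\<^sup>2"
  shows "prob {w \<in> space M. \<delta> \<le> \<bar>(\<Sum>i<n. W i w) / real n - e\<bar>} \<le> 1 / (real n * \<delta>\<^sup>2)"
proof -
  let ?V = "\<lambda>w. (\<Sum>i<n. W i w) / real n"
  have int: "integrable M (W i)" if "i < n" for i
    using bounded[OF that] by (intro integrable_const_bound[where B = 1] AE_I2 W that) auto
  have prod_le: "\<bar>W i w * W j w\<bar> \<le> 1" if "i < n" "j < n" "w \<in> space M" for i j w
    unfolding abs_mult by (intro mult_le_one bounded that) auto
  have int2: "integrable M (\<lambda>w. W i w * W j w)" if "i < n" "j < n" for i j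
    using prod_le that by (intro integrable_const_bound[where B = 1] AE_I2 borel_measurable_times W) auto
  have sq: "(?V w)\<^sup>2 = (\<Sum>i<n. \<Sum>j<n. W i w * W j w) / (real n)\<^sup>2" for w
    by (simp add: power2_eq_square sum_product)
  have V_int: "integrable M ?V"
    by (intro integrable_divide Bochner_Integration.integrable_sum int) simp
  have sq_int: "integrable M (\<lambda>w. (?V w)\<^sup>2)"
    unfolding sq by (intro integrable_divide Bochner_Integration.integrable_sum int2) auto
  have V: "expectation ?V = e"
    using n by (simp add: int mean)
  \<comment> \<open>The diagonal is overestimated by \<open>1 + e\<^sup>2\<close>, so that all
    entries share the part \<open>e\<^sup>2\<close>, which the square of the mean removes
    again.\<close>
  have "expectation (\<lambda>w. W i w * W j w) \<le> (if i = j then 1 else 0) + e\<^sup>2" if "i < n" "j < n" for i j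
  proof (cases "i = j")
    case True
    have "expectation (\<lambda>w. W i w * W j w) \<le> 1"
      by (intro integral_le_const int2 AE_I2 that order_trans[OF abs_ge_self prod_le])
    then show ?thesis using True by (simp add: add_increasing2)
  qed (use uncorrelated that in simp)
  moreover have "expectation (\<lambda>w. \<Sum>i<n. \<Sum>j<n. W i w * W j w) =
      (\<Sum>i<n. \<Sum>j<n. expectation (\<lambda>w. W i w * W j w))"
  proof -
    have "expectation (\<lambda>w. \<Sum>i<n. \<Sum>j<n. W i w * W j w) = (\<Sum>i<n. expectation (\<lambda>w. \<Sum>j<n. W i w * W j w))"
      by (rule Bochner_Integration.integral_sum) (auto intro!: Bochner_Integration.integrable_sum int2)
    also have "\<dots> = (\<Sum>i<n. \<Sum>j<n. expectation (\<lambda>w. W i w * W j w))"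
      by (intro sum.cong refl Bochner_Integration.integral_sum) (auto intro!: int2)
    finally show ?thesis .
  qed
  ultimately have "expectation (\<lambda>w. (?V w)\<^sup>2) \<le> (\<Sum>i<n. \<Sum>j<n. (if i = j then 1 else 0) + e\<^sup>2) / (real n)\<^sup>2"
    unfolding sq by (simp only: Bochner_Integration.integral_divide_zero) (intro divide_right_mono sum_mono; simp)
  also have "\<dots> = 1 / real n + e\<^sup>2"
    using n by (simp add: sum.distrib power2_eq_square field_simps)
  finally have var: "variance ?V \<le> 1 / real n"
    using V by (subst variance_eq[OF V_int sq_int]) simp
  have "prob {w \<in> space M. \<delta> \<le> \<bar>?V w - expectation ?V\<bar>} \<le> variance ?V / \<delta>\<^sup>2"
    by (intro Chebyshev_inequality \<delta> sq_int borel_measurable_integrable[OF V_int])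
  also have "\<dots> \<le> (1 / real n) / \<delta>\<^sup>2"
    using var by (intro divide_right_mono) auto
  finally show ?thesis using V by simp
qed

text \<open>Factors outside \<open>J\<close> are filled in by the constant \<open>1\<close>, whose
  integral is \<open>1\<close> under a probability measure.\<close>

lemma integral_PiM_prod_subset:
  fixes h :: "nat \<Rightarrow> 'c \<Rightarrow> real"
  assumes "prob_space Q" "J \<subseteq> {..<n}" "\<And>i. i \<in> J \<Longrightarrow> integrable Q (h i)"
  shows "(\<integral>x. (\<Prod>i\<in>J. h i (x i)) \<partial>Pi\<^sub>M {..<n} (\<lambda>_. Q)) = (\<Prod>i\<in>J. integral\<^sup>L Q (h i))"
proof -
  interpret prob_space Q by fact
  interpret product_sigma_finite "\<lambda>_::nat. Q" by standard
  let ?h = "\<lambda>i. if i \<in> J then h i else (\<lambda>_. 1)"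
  have "(\<Prod>i\<in>J. h i (x i)) = (\<Prod>i<n. ?h i (x i))" for x
    using assms(2) by (intro prod.mono_neutral_cong_left) auto
  then have "(\<integral>x. (\<Prod>i\<in>J. h i (x i)) \<partial>Pi\<^sub>M {..<n} (\<lambda>_. Q)) = (\<Prod>i<n. integral\<^sup>L Q (?h i))"
    using assms(3) by (simp only:) (intro product_integral_prod, auto)
  also have "\<dots> = (\<Prod>i\<in>J. integral\<^sup>L Q (h i))"
    using assms(2) by (intro prod.mono_neutral_cong_right) (auto simp: prob_space)
  finally show ?thesis .
qed

section \<open>Conditioning on the state and joint moments of the choices\<close>

context market
begin

lemma state_sets: "{w \<in> space M. A w = a} \<in> sets M"
  using measurable_sets[OF state(1), of "{a}"] by (simp add: vimage_def Int_def conj_commute)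

lemma prob_state: "prob {w \<in> space M. A w = a} = pmf \<rho> a"
proof -
  have "pmf \<rho> a = measure (distr M (count_space UNIV) A) {a}"
    unfolding state(2) by (simp add: pmf.rep_eq)
  also have "\<dots> = prob {w \<in> space M. A w = a}"
    by (subst measure_distr[OF state(1)]) (auto intro!: arg_cong[where f = prob])
  finally show ?thesis by simp
qed

lemma space_given_state [simp]: "space (given_state M A a) = space M"
  and sets_given_state [simp, measurable_cong]: "sets (given_state M A a) = sets M"
  by (simp_all add: given_state_def)

lemma prob_space_given_state:
  assumes "a \<in> set_pmf \<rho>"
  shows "prob_space (given_state M A a)"
  unfolding given_state_def using assms prob_state[of a]
  by (intro prob_space_uniform_measure) (auto simp: emeasure_eq_measure set_pmf_iff)

text \<open>Conditioning divides by \<open>pmf \<rho> a\<close>, which is at most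
  \<open>1\<close>.\<close>

lemma prob_Int_state:
  assumes "a \<in> set_pmf \<rho>" "F \<in> sets M"
  shows "prob (F \<inter> {w \<in> space M. A w = a}) \<le> measure (given_state M A a) F"
proof -
  have p: "0 < pmf \<rho> a" using assms(1) by (simp add: pmf_positive)
  have "measure (given_state M A a) F = prob ({w \<in> space M. A w = a} \<inter> F) / pmf \<rho> a"
    unfolding given_state_def
    using assms p prob_state[of a] state_sets[of a]
    by (subst measure_uniform_measure) (auto simp: emeasure_eq_measure)
  moreover have "prob (F \<inter> {w \<in> space M. A w = a}) * pmf \<rho> a \<le> prob (F \<inter> {w \<in> space M. A w = a}) * 1"
    by (intro mult_left_mono) (auto simp: pmf_le_1)
  ultimately show ?thesis using p by (simp add: Int_commute pos_le_divide_eq)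
qed

text \<open>No measurability of \<open>E\<close> is at hand: it is covered by measurable sets, and
  monotonicity of \<open>measure\<close> asks measurability of the larger set. States outside the
  support of \<open>\<rho>\<close> contribute a null set.\<close>

lemma prob_le_sum_states:
  assumes fin: "finite (set_pmf \<rho>)"
    and F: "\<And>a. a \<in> set_pmf \<rho> \<Longrightarrow> F a \<in> sets M"
    and E: "\<And>w. w \<in> E \<Longrightarrow> w \<in> space M \<and> (A w \<in> set_pmf \<rho> \<longrightarrow> w \<in> F (A w))"
  shows "prob E \<le> (\<Sum>a\<in>set_pmf \<rho>. measure (given_state M A a) (F a))"
proof -
  let ?O = "{w \<in> space M. A w \<notin> set_pmf \<rho>}"
  let ?S = "\<lambda>a. F a \<inter> {w \<in> space M. A w = a}"
  have O: "?O \<in> sets M"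
    using measurable_sets[OF state(1), of "- set_pmf \<rho>"] by (simp add: vimage_def Int_def conj_commute)
  have "prob ?O = measure (distr M (count_space UNIV) A) (- set_pmf \<rho>)"
    by (subst measure_distr[OF state(1)]) (auto intro!: arg_cong[where f = prob])
  also have "\<dots> = 0"
    unfolding state(2) using measure_pmf.prob_compl[of "set_pmf \<rho>" \<rho>]
    by (simp add: Compl_eq_Diff_UNIV measure_pmf.prob_eq_1 AE_measure_pmf)
  finally have O0: "prob ?O = 0" .
  have S: "?S a \<in> sets M" if "a \<in> set_pmf \<rho>" for a
    using F[OF that] state_sets by auto
  have "prob E \<le> prob (?O \<union> (\<Union>a\<in>set_pmf \<rho>. ?S a))"
    using E O S fin by (intro finite_measure_mono sets.Un sets.finite_UN) auto
  also have "\<dots> \<le> prob ?O + prob (\<Union>a\<in>set_pmf \<rho>. ?S a)"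
    using O S fin by (intro measure_Un_le sets.finite_UN) auto
  also have "\<dots> \<le> 0 + (\<Sum>a\<in>set_pmf \<rho>. prob (?S a))"
    unfolding O0 using S fin by (intro add_left_mono finite_measure_subadditive_finite) auto
  also have "\<dots> \<le> 0 + (\<Sum>a\<in>set_pmf \<rho>. measure (given_state M A a) (F a))"
    by (intro add_left_mono sum_mono prob_Int_state F)
  finally show ?thesis by simp
qed

lemma primitives_measurable: "primitives \<in> M \<rightarrow>\<^sub>M primitives_space"
  unfolding primitives_def primitives_space_def using demand(1) feature payment
  by (intro measurable_Pair measurable_restrict) auto

text \<open>Under the product law demand integrates out, payments are integrated for fixed features,
  and the resulting product over features factorises again. The suppliers share one law, so only the
  size of \<open>J\<close> remains.\<close>

lemma product_moment:
  fixes \<phi> :: "'b \<times> real \<Rightarrow> real"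
  assumes a: "a \<in> set_pmf \<rho>" and J: "J \<subseteq> {..<n}"
    and \<phi>: "\<phi> \<in> borel_measurable (\<B> \<Otimes>\<^sub>M borel)" "\<And>b y. b \<in> space \<B> \<Longrightarrow> \<bar>\<phi> (b, y)\<bar> \<le> 1"
  shows "(\<integral>w. (\<Prod>i\<in>J. \<phi> (B i w, P i w)) \<partial>given_state M A a) = (\<integral>b. \<integral>y. \<phi> (b, y) \<partial>\<pi> \<partial>\<nu> a) ^ card J"
proof -
  let ?N = "given_state M A a"
  let ?PB = "Pi\<^sub>M {..<n} (\<lambda>_. \<nu> a)" and ?PP = "Pi\<^sub>M {..<n} (\<lambda>_. \<pi>)" and ?DD = "distr ?N borel D"
  interpret N: prob_space ?N by (rule prob_space_given_state[OF a])
  interpret nu: prob_space "\<nu> a" using feature_law[OF a] by simp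
  interpret pay: prob_space \<pi> by (rule payment_law(1))
  have sets_nu [measurable_cong, simp]: "sets (\<nu> a) = sets \<B>" using feature_law[OF a] by simp
  have sets_pi [measurable_cong, simp]: "sets \<pi> = sets borel" by (rule payment_law(2))
  have space_nu: "space (\<nu> a) = space \<B>" using sets_nu by (rule sets_eq_imp_space_eq)
  have D[measurable]: "D \<in> ?N \<rightarrow>\<^sub>M borel" using demand(1) by simp
  interpret PB: product_prob_space "\<lambda>_. \<nu> a" "{..<n}" by standard
  interpret PP: product_prob_space "\<lambda>_. \<pi>" "{..<n}" by standard
  interpret DD: prob_space ?DD by (rule N.prob_space_distr) simp
  interpret BP: pair_prob_space ?PB ?PP by standard
  interpret DBP: pair_prob_space ?DD "?PB \<Otimes>\<^sub>M ?PP" by standard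
  have [measurable]: "\<phi> \<in> borel_measurable (\<nu> a \<Otimes>\<^sub>M \<pi>)"
    using \<phi>(1) by (simp cong: measurable_cong_sets add: sets_pair_measure_cong[OF sets_nu sets_pi])
  define F where "F = (\<lambda>x :: real \<times> (nat \<Rightarrow> 'b) \<times> (nat \<Rightarrow> real). \<Prod>i\<in>J. \<phi> (fst (snd x) i, snd (snd x) i))"
  have J': "i \<in> {..<n}" if "i \<in> J" for i using J that by auto
  have F: "F \<in> borel_measurable (?DD \<Otimes>\<^sub>M (?PB \<Otimes>\<^sub>M ?PP))"
    unfolding F_def
  proof (rule borel_measurable_prod)
    fix i assume "i \<in> J"
    then have i: "i \<in> {..<n}" by (rule J')
    note snd = measurable_snd[of ?DD "?PB \<Otimes>\<^sub>M ?PP"]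
    have "(\<lambda>x. (fst (snd x) i, snd (snd x) i)) \<in> (?DD \<Otimes>\<^sub>M (?PB \<Otimes>\<^sub>M ?PP)) \<rightarrow>\<^sub>M (\<nu> a \<Otimes>\<^sub>M \<pi>)"
      by (rule measurable_Pair[OF
            measurable_compose[OF measurable_compose[OF snd measurable_fst] measurable_component_singleton[OF i]]
            measurable_compose[OF measurable_compose[OF snd measurable_snd] measurable_component_singleton[OF i]]])
    then show "(\<lambda>x. \<phi> (fst (snd x) i, snd (snd x) i)) \<in> borel_measurable (?DD \<Otimes>\<^sub>M (?PB \<Otimes>\<^sub>M ?PP))"
      by (rule measurable_compose) fact
  qed
  have F_le: "\<bar>F x\<bar> \<le> 1" if "x \<in> space (?DD \<Otimes>\<^sub>M (?PB \<Otimes>\<^sub>M ?PP))" for x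
    unfolding F_def abs_prod using that J
    by (intro prod_le_1 conjI \<phi>(2))
       (auto simp: space_pair_measure space_PiM PiE_def Pi_def space_nu)
  have int_phi: "integrable \<pi> (\<lambda>y. \<phi> (b, y))" if "b \<in> space \<B>" for b
    using that \<phi>(2) by (intro pay.integrable_const_bound[where B = 1] AE_I2) (auto simp: space_nu)
  have int_Phi: "integrable (\<nu> a) (\<lambda>b. \<integral>y. \<phi> (b, y) \<partial>\<pi>)"
  proof (intro nu.integrable_const_bound[where B = 1] AE_I2)
    fix b assume "b \<in> space (\<nu> a)"
    then have "b \<in> space \<B>" by (simp add: space_nu)
    then have "(\<integral>y. \<bar>\<phi> (b, y)\<bar> \<partial>\<pi>) \<le> 1"
      using \<phi>(2) int_phi by (intro pay.integral_le_const) auto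
    then show "norm (\<integral>y. \<phi> (b, y) \<partial>\<pi>) \<le> 1"
      unfolding real_norm_def by (rule order_trans[OF integral_abs_bound])
  qed measurable
  have int_F: "integrable (?DD \<Otimes>\<^sub>M (?PB \<Otimes>\<^sub>M ?PP)) F"
    using F F_le by (intro DBP.integrable_const_bound[where B = 1] AE_I2) auto
  have int_F2: "integrable (?PB \<Otimes>\<^sub>M ?PP) (\<lambda>x. F (t, x))" for t
    using measurable_compose[OF measurable_Pair1' F, of t] F_le[of "(t, _)"]
    by (intro BP.integrable_const_bound[where B = 1] AE_I2) (auto simp: space_pair_measure)
  have inner: "(\<integral>ps. F (t, bs, ps) \<partial>?PP) = (\<Prod>i\<in>J. \<integral>y. \<phi> (bs i, y) \<partial>\<pi>)" if "bs \<in> space ?PB" for t bs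
    unfolding F_def fst_conv snd_conv
    using that J by (intro integral_PiM_prod_subset payment_law J int_phi)
      (auto simp: space_PiM PiE_def Pi_def space_nu)
  have "(\<integral>w. (\<Prod>i\<in>J. \<phi> (B i w, P i w)) \<partial>?N) = (\<integral>w. F (primitives w) \<partial>?N)"
    using J' by (intro Bochner_Integration.integral_cong refl) (auto simp: F_def primitives_def intro!: prod.cong)
  also have "\<dots> = (\<integral>x. F x \<partial>distr ?N primitives_space primitives)"
  proof (rule integral_distr[symmetric])
    show "primitives \<in> ?N \<rightarrow>\<^sub>M primitives_space" using primitives_measurable by simp
    show "F \<in> borel_measurable primitives_space"
      using F by (simp add: primitives_law[OF a, symmetric])
  qed
  also have "\<dots> = (\<integral>x. F x \<partial>(?DD \<Otimes>\<^sub>M (?PB \<Otimes>\<^sub>M ?PP)))"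
    by (simp add: primitives_law[OF a])
  also have "\<dots> = (\<integral>t. \<integral>x. F (t, x) \<partial>(?PB \<Otimes>\<^sub>M ?PP) \<partial>?DD)"
    by (rule DBP.integral_fst'[symmetric]) (rule int_F)
  also have "\<dots> = (\<integral>t. \<integral>bs. \<integral>ps. F (t, bs, ps) \<partial>?PP \<partial>?PB \<partial>?DD)"
    by (intro Bochner_Integration.integral_cong refl BP.integral_fst'[symmetric] int_F2)
  also have "\<dots> = (\<integral>t. \<integral>bs. (\<Prod>i\<in>J. \<integral>y. \<phi> (bs i, y) \<partial>\<pi>) \<partial>?PB \<partial>?DD)"
    by (intro Bochner_Integration.integral_cong refl inner)
  also have "\<dots> = (\<Prod>i\<in>J. \<integral>b. \<integral>y. \<phi> (b, y) \<partial>\<pi> \<partial>\<nu> a)"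
    by (subst integral_PiM_prod_subset[OF nu.prob_space_axioms J int_Phi]) (use DD.prob_space in simp)
  finally show ?thesis by simp
qed

text \<open>The law of one payment is contained in the joint law of the primitives; it is recovered
  as the moment, for \<open>J = {i}\<close>, of the indicator of a null set of payments.\<close>

lemma AE_payment:
  assumes a: "a \<in> set_pmf \<rho>" and i: "i < n" and Q: "AE y in \<pi>. Q y"
  shows "AE w in given_state M A a. Q (P i w)"
proof -
  interpret N: prob_space "given_state M A a" by (rule prob_space_given_state[OF a])
  interpret nu: prob_space "\<nu> a" using feature_law[OF a] by simp
  obtain S where S: "{y \<in> space \<pi>. \<not> Q y} \<subseteq> S" "S \<in> null_sets \<pi>"
    using Q unfolding eventually_ae_filter by blast
  then have [measurable]: "S \<in> sets borel" using payment_law(2) by auto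
  have P[measurable]: "P i \<in> borel_measurable (given_state M A a)" using payment[OF i] by simp
  have "measure (given_state M A a) (P i -` S \<inter> space M) = (\<integral>w. (indicator S (P i w) :: real) \<partial>given_state M A a)"
  proof -
    have "(\<integral>w. (indicator S (P i w) :: real) \<partial>given_state M A a) =
        (\<integral>w. indicator (P i -` S \<inter> space M) w \<partial>given_state M A a)"
      by (intro Bochner_Integration.integral_cong) (auto simp: indicator_def)
    then show ?thesis by (simp add: Int_assoc)
  qed
  also have "\<dots> = (\<integral>b. \<integral>y. (indicator S y :: real) \<partial>\<pi> \<partial>\<nu> a)"
    using product_moment[OF a, of "{i}" "\<lambda>(b, y). indicator S y"] i by auto
  also have "\<dots> = 0" using S(2) by (simp add: measure_eq_emeasure_eq_ennreal null_setsD1 measure_def)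
  finally have "P i -` S \<inter> space M \<in> null_sets (given_state M A a)"
    using measurable_sets[OF P, of S] by (intro null_setsI) (auto simp: N.emeasure_eq_measure)
  moreover have "space \<pi> = UNIV" using sets_eq_imp_space_eq[OF payment_law(2)] by simp
  ultimately show ?thesis using S(1) by (auto intro!: AE_I' simp: subset_eq)
qed

text \<open>Conditioning on the primitives: the weights \<open>h (P i)\<close> are known there and
  leave the conditional expectation, which \<open>choice\<close> replaces by a product of choice
  probabilities. \<open>\<psi>\<close> stands in for \<open>f b (y * \<Omega>bar a)\<close> because
  measurability of \<open>f\<close> is given in \<open>b\<close> for each fixed reward, not
  jointly.\<close>

lemma choice_moment:
  fixes \<psi> :: "'b \<times> real \<Rightarrow> real" and h :: "real \<Rightarrow> real"
  assumes a: "a \<in> set_pmf \<rho>" and J: "J \<subseteq> {..<n}"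
    and \<psi>: "\<psi> \<in> borel_measurable (\<B> \<Otimes>\<^sub>M borel)" "\<And>b y. b \<in> space \<B> \<Longrightarrow> \<bar>\<psi> (b, y)\<bar> \<le> 1"
      "AE y in \<pi>. \<forall>b\<in>space \<B>. f b (y * \<Omega>bar a) = \<psi> (b, y)"
    and h: "h \<in> borel_measurable borel" "\<And>y. \<bar>h y\<bar> \<le> 1"
  shows "(\<integral>w. (\<Prod>i\<in>J. Z i w * h (P i w)) \<partial>given_state M A a) =
    (\<integral>b. \<integral>y. \<psi> (b, y) * h y \<partial>\<pi> \<partial>\<nu> a) ^ card J"
proof -
  let ?N = "given_state M A a" and ?F = "vimage_algebra (space M) primitives primitives_space"
  interpret N: prob_space ?N by (rule prob_space_given_state[OF a])
  have prim_space: "primitives \<in> space M \<rightarrow> space primitives_space"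
    using measurable_space[OF primitives_measurable] by auto
  have sub: "subalgebra ?N ?F"
    unfolding subalgebra_def using measurable_sets[OF primitives_measurable]
    by (auto simp: sets_vimage_algebra2[OF prim_space])
  interpret finite_measure_subalgebra ?N ?F
    by standard (rule sub)
  interpret sigma_finite_subalgebra ?N ?F
    by (rule finite_measure_subalgebra_is_sigma_finite) (rule finite_measure_subalgebra_axioms)
  have prim: "primitives \<in> ?F \<rightarrow>\<^sub>M primitives_space"
    by (rule measurable_vimage_algebra1[OF prim_space])
  have fin: "finite J" using J finite_subset by blast
  have i: "i < n" if "i \<in> J" for i using that J by auto
  have P: "P i \<in> borel_measurable ?F" if "i < n" for i
  proof -
    have "(\<lambda>x. snd (snd x) i) \<in> primitives_space \<rightarrow>\<^sub>M borel"
      unfolding primitives_space_def using that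
      by (intro measurable_compose[OF measurable_compose[OF measurable_snd measurable_snd]
            measurable_component_singleton]) simp
    from measurable_compose[OF prim this] show ?thesis
      using that by (simp add: primitives_def)
  qed
  have Z[measurable]: "Z i \<in> borel_measurable ?N" if "i < n" for i using active(1)[OF that] by simp
  have P'[measurable]: "P i \<in> borel_measurable ?N" if "i < n" for i using payment[OF that] by simp
  have B'[measurable]: "B i \<in> ?N \<rightarrow>\<^sub>M \<B>" if "i < n" for i using feature[OF that] by simp
  have B_space: "B i w \<in> space \<B>" if "i < n" "w \<in> space M" for i w
    using feature[OF that(1)] that(2) by (rule measurable_space)
  let ?h = "\<lambda>w. \<Prod>i\<in>J. h (P i w)" and ?Z = "\<lambda>w. \<Prod>i\<in>J. Z i w"
  have h_meas: "?h \<in> borel_measurable ?F"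
    by (intro borel_measurable_prod measurable_compose[OF P h(1)] i)
  have Z_meas: "?Z \<in> borel_measurable ?N"
    by (intro borel_measurable_prod Z i)
  have h_meas': "?h \<in> borel_measurable ?N"
    by (intro borel_measurable_prod measurable_compose[OF P' h(1)] i)
  have "\<bar>?h w\<bar> \<le> 1" for w
    unfolding abs_prod using h(2) by (intro prod_le_1) auto
  moreover have "\<bar>?Z w\<bar> \<le> 1" if "w \<in> space M" for w
    unfolding abs_prod using active(2)[OF i that] by (intro prod_le_1) fastforce
  ultimately have int: "integrable ?N (\<lambda>w. ?h w * ?Z w)"
    by (intro N.integrable_const_bound[where B = 1] AE_I2 borel_measurable_times h_meas' Z_meas)
       (auto simp: abs_mult intro: mult_le_one)
  have "AE w in ?N. \<forall>i\<in>J. \<forall>b\<in>space \<B>. f b (P i w * \<Omega>bar a) = \<psi> (b, P i w)"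
    by (rule AE_finite_allI[OF fin]) (rule AE_payment[OF a i \<psi>(3)])
  with choice[OF a J] AE_space have AE: "AE w in ?N. ?h w * real_cond_exp ?N ?F ?Z w =
      (\<Prod>i\<in>J. (\<lambda>(b, y). \<psi> (b, y) * h y) (B i w, P i w))"
  proof eventually_elim
    case (elim w)
    then have "real_cond_exp ?N ?F ?Z w = (\<Prod>i\<in>J. \<psi> (B i w, P i w))"
      using B_space i by (auto intro!: prod.cong)
    then show ?case by (simp add: prod.distrib mult.commute)
  qed
  have "(\<integral>w. (\<Prod>i\<in>J. Z i w * h (P i w)) \<partial>?N) = (\<integral>w. ?h w * ?Z w \<partial>?N)"
    by (simp add: prod.distrib mult.commute)
  also have "\<dots> = (\<integral>w. ?h w * real_cond_exp ?N ?F ?Z w \<partial>?N)"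
    by (rule real_cond_exp_intg(2)[OF int h_meas Z_meas, symmetric])
  also have "\<dots> = (\<integral>w. (\<Prod>i\<in>J. (\<lambda>(b, y). \<psi> (b, y) * h y) (B i w, P i w)) \<partial>?N)"
  proof (rule integral_cong_AE[OF _ _ AE])
    show "(\<lambda>w. ?h w * real_cond_exp ?N ?F ?Z w) \<in> borel_measurable ?N"
      using h_meas' by (intro borel_measurable_times borel_measurable_cond_exp2)
    show "(\<lambda>w. \<Prod>i\<in>J. (\<lambda>(b, y). \<psi> (b, y) * h y) (B i w, P i w)) \<in> borel_measurable ?N"
      using \<psi>(1) h(1) i by (intro borel_measurable_prod) (simp, measurable)
  qed
  also have "\<dots> = (\<integral>b. \<integral>y. \<psi> (b, y) * h y \<partial>\<pi> \<partial>\<nu> a) ^ card J"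
  proof (subst product_moment[OF a J])
    show "(\<lambda>(b, y). \<psi> (b, y) * h y) \<in> borel_measurable (\<B> \<Otimes>\<^sub>M borel)"
      using \<psi>(1) h(1) by measurable
    show "\<bar>(\<lambda>(b, y). \<psi> (b, y) * h y) (b, y)\<bar> \<le> 1" if "b \<in> space \<B>" for b y
      using \<psi>(2)[OF that, of y] h(2)[of y] by (simp add: abs_mult mult_le_one)
  qed simp
  finally show ?thesis .
qed

end

section \<open>Bounds and ray limits of the allocation function, and two-point payments\<close>

lemma allocation_bounded:
  assumes "allocation_function \<omega> \<Omega>"
  obtains K where "\<And>d t. 0 \<le> d \<Longrightarrow> 0 \<le> t \<Longrightarrow> \<Omega> d t \<le> K"
proof -
  have reg: "regular_allocation \<omega>"
    using assms by (simp add: allocation_function_def)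
  then obtain L where L: "(\<omega> \<longlongrightarrow> L) at_top" "L \<le> 1"
    unfolding regular_allocation_def by blast
  from assms obtain l where "error_term l"
    and \<Omega>: "\<And>d t. 0 \<le> d \<Longrightarrow> 0 \<le> t \<Longrightarrow> \<Omega> d t = (if t = 0 then Lim at_top \<omega> else \<omega> (d / t)) + l d t"
    by (auto simp: allocation_function_def)
  then obtain C where l: "\<And>d t. 0 \<le> d \<Longrightarrow> 0 \<le> t \<Longrightarrow> \<bar>l d t\<bar> \<le> C"
    unfolding error_term_def by blast
  have "Lim at_top \<omega> = L" using L(1) by (intro tendsto_Lim) auto
  then have "\<Omega> d t \<le> 1 + C" if "0 \<le> d" "0 \<le> t" for d t
  proof -
    have "(if t = 0 then Lim at_top \<omega> else \<omega> (d / t)) \<le> 1"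
      using \<open>Lim at_top \<omega> = L\<close> L(2) reg that by (auto simp: regular_allocation_def)
    then show ?thesis unfolding \<Omega>[OF that] using l[OF that] by linarith
  qed
  then show ?thesis by (rule that)
qed

text \<open>On a ray both coordinates grow while their ratio is fixed, which is the regime in which
  the error term is controlled; its little-o bound, taken with constant \<open>1\<close>, squeezes
  it to \<open>0\<close>.\<close>

lemma allocation_ray_limit:
  assumes \<Omega>: "allocation_function \<omega> \<Omega>" and "0 < x" "0 < m"
  shows "(\<lambda>n. \<Omega> (x * real n) (m * real n)) \<longlonglongrightarrow> \<omega> (x / m)"
proof -
  from \<Omega> obtain l where
    l: "(\<lambda>(d, t). l d t) \<in> o[at_top \<times>\<^sub>F at_top](\<lambda>(d, t). 1 / sqrt t + 1 / sqrt d)"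
    and eq: "\<And>d t. 0 \<le> d \<Longrightarrow> 0 \<le> t \<Longrightarrow> \<Omega> d t = (if t = 0 then Lim at_top \<omega> else \<omega> (d / t)) + l d t"
    by (auto simp: allocation_function_def error_term_def)
  have lin: "filterlim (\<lambda>n. c * real n) at_top sequentially" if "0 < c" for c
    using that filterlim_real_sequentially by (intro filterlim_tendsto_pos_mult_at_top[OF tendsto_const])
  have ray: "filterlim (\<lambda>n. (x * real n, m * real n)) (at_top \<times>\<^sub>F at_top) sequentially"
    using assms by (intro filterlim_Pair lin)
  have "\<forall>\<^sub>F n in sequentially. norm (l (x * real n) (m * real n)) \<le> 1 / sqrt (m * real n) + 1 / sqrt (x * real n)"
    using eventually_compose_filterlim[OF landau_o.smallD[OF l zero_less_one] ray]
    by (rule eventually_mono) (use assms in \<open>simp add: abs_of_nonneg add_nonneg_nonneg\<close>)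
  moreover have "(\<lambda>n. 1 / sqrt (m * real n) + 1 / sqrt (x * real n)) \<longlonglongrightarrow> 0"
    using assms by (intro tendsto_add_zero real_tendsto_divide_at_top[OF tendsto_const]
        filterlim_compose[OF sqrt_at_top] lin)
  ultimately have "(\<lambda>n. l (x * real n) (m * real n)) \<longlonglongrightarrow> 0"
    by (rule Lim_null_comparison)
  then have "(\<lambda>n. \<omega> (x / m) + l (x * real n) (m * real n)) \<longlonglongrightarrow> \<omega> (x / m) + 0"
    by (intro tendsto_intros)
  moreover have "\<forall>\<^sub>F n in sequentially. \<omega> (x / m) + l (x * real n) (m * real n) = \<Omega> (x * real n) (m * real n)"
    using eventually_gt_at_top[of 0] by eventually_elim (use assms in \<open>simp add: eq\<close>)
  ultimately show ?thesis by (simp add: Lim_transform_eventually)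
qed

lemma integral_perturbed_payment:
  assumes "h \<in> borel_measurable borel"
  shows "(\<integral>y. h y \<partial>perturbed_payment p z) = (h (p + z) + h (p - z)) / (2::real)"
  unfolding perturbed_payment_def
  using assms by (subst integral_distr) (auto simp: integral_pmf_of_set)

lemma AE_perturbed_payment: "AE y in perturbed_payment p z. y = p + z \<or> y = p - z"
  unfolding perturbed_payment_def
  by (subst AE_distr_iff) (auto simp: AE_measure_pmf_iff)

section \<open>Mean allocation and concentration of averages in one market\<close>

context market
begin

lemma T_range:
  assumes "w \<in> space M"
  shows "T w \<in> real ` {..n}"
proof -
  have "T w = (\<Sum>i<n. if Z i w = 1 then 1 else 0)"
    unfolding T_def using active(2)[OF _ assms] by (intro sum.cong) fastforce+
  also have "\<dots> = real (card {i \<in> {..<n}. Z i w = 1})"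
    by (simp add: sum.If_cases Int_def)
  finally show ?thesis
    using card_mono[of "{..<n}" "{i \<in> {..<n}. Z i w = 1}"] by auto
qed

lemma T_measurable: "T \<in> borel_measurable M"
  unfolding T_def using active(1) by (intro borel_measurable_sum) auto

text \<open>Joint measurability of \<open>\<Omega>\<close> is not given. For a fixed second argument
  it is monotone in demand, hence measurable, and \<open>T\<close> takes finitely many values, so a
  finite sum suffices. \<open>max 0\<close> extends monotonicity to the whole line.\<close>

lemma allocation_measurable:
  assumes \<Omega>: "allocation_function \<omega> \<Omega>"
  shows "(\<lambda>w. \<Omega> (D w) (T w)) \<in> borel_measurable M"
proof -
  have D[measurable]: "D \<in> borel_measurable M" and T[measurable]: "T \<in> borel_measurable M"
    by (fact demand(1)) (fact T_measurable)
  have mono: "mono (\<lambda>x. \<Omega> (max 0 x) (real k))" for k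
    using \<Omega> by (auto simp: allocation_function_def mono_on_def intro!: monoI)
  have [measurable]: "(\<lambda>w. \<Omega> (max 0 (D w)) (real k)) \<in> borel_measurable M" for k
    by (rule measurable_compose[OF D borel_measurable_mono[OF mono]])
  have "(\<lambda>w. \<Sum>k\<le>n. indicator {w \<in> space M. T w = real k} w * \<Omega> (max 0 (D w)) (real k)) \<in> borel_measurable M"
    by measurable
  also have "?this \<longleftrightarrow> ?thesis"
  proof (rule measurable_cong)
    fix w assume w: "w \<in> space M"
    then obtain j where j: "j \<le> n" "T w = real j" using T_range by auto
    have "(\<Sum>k\<le>n. indicator {w \<in> space M. T w = real k} w * \<Omega> (max 0 (D w)) (real k)) =
        (\<Sum>k\<in>{j}. indicator {w \<in> space M. T w = real k} w * \<Omega> (max 0 (D w)) (real k))"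
      using j by (intro sum.mono_neutral_right) auto
    then show "(\<Sum>k\<le>n. indicator {w \<in> space M. T w = real k} w * \<Omega> (max 0 (D w)) (real k)) = \<Omega> (D w) (T w)"
      using w j demand(2)[OF w] by simp
  qed
  finally show ?thesis .
qed

context
  fixes \<omega> a K
  assumes \<Omega>: "allocation_function \<omega> \<Omega>" and a: "a \<in> set_pmf \<rho>"
    and K: "\<And>d t. 0 \<le> d \<Longrightarrow> 0 \<le> t \<Longrightarrow> \<Omega> d t \<le> K"
begin

lemma allocation_range:
  assumes "w \<in> space M"
  shows "0 \<le> \<Omega> (D w) (T w)" "\<Omega> (D w) (T w) \<le> K" "0 \<le> T w"
  using \<Omega> K demand(2)[OF assms] T_range[OF assms] by (auto simp: allocation_function_def)

lemma allocation_integrable: "integrable (given_state M A a) (\<lambda>w. \<Omega> (D w) (T w))"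
proof -
  interpret N: prob_space "given_state M A a" by (rule prob_space_given_state[OF a])
  show ?thesis
    using allocation_measurable[OF \<Omega>] allocation_range
    by (intro N.integrable_const_bound[where B = K] AE_I2) auto
qed

lemma allocation_mono:
  assumes "0 \<le> d" "d \<le> d'" "0 \<le> t'" "t' \<le> t"
  shows "\<Omega> d t \<le> \<Omega> d' t'"
proof -
  have "\<Omega> d t \<le> \<Omega> d' t" using \<Omega> assms by (auto simp: allocation_function_def mono_on_def)
  also have "\<dots> \<le> \<Omega> d' t'" using \<Omega> assms by (auto simp: allocation_function_def monotone_on_def)
  finally show ?thesis .
qed

lemma mean_allocation_nonneg: "0 \<le> \<Omega>bar a"
  unfolding \<Omega>bar_def using allocation_range by (intro integral_nonneg_AE AE_I2) auto

text \<open>Where demand is at least \<open>d\<close> and \<open>T\<close> is at most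
  \<open>t\<close>, monotonicity bounds the integrand below by \<open>\<Omega> d t\<close>;
  elsewhere it is at least \<open>0\<close>. The two exceptional probabilities enter through a union
  bound.\<close>

lemma mean_allocation_lower:
  assumes "0 \<le> d" "0 \<le> t"
  shows "\<Omega> d t * (1 - (measure (given_state M A a) {w \<in> space M. D w < d} +
    measure (given_state M A a) {w \<in> space M. t < T w})) \<le> \<Omega>bar a"
proof -
  let ?N = "given_state M A a"
  interpret N: prob_space ?N by (rule prob_space_given_state[OF a])
  let ?B = "{w \<in> space M. D w < d} \<union> {w \<in> space M. t < T w}"
  have [measurable]: "D \<in> borel_measurable M" "T \<in> borel_measurable M"
    by (fact demand(1)) (fact T_measurable)
  have B: "{w \<in> space M. D w < d} \<in> sets M" "{w \<in> space M. t < T w} \<in> sets M" "?B \<in> sets M"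
    by measurable
  have nonneg: "0 \<le> \<Omega> d t" using \<Omega> assms by (auto simp: allocation_function_def)
  have "1 - measure ?N ?B = measure ?N (space M - ?B)"
    using B by (subst N.prob_compl[simplified]) auto
  moreover have "measure ?N ?B \<le> measure ?N {w \<in> space M. D w < d} + measure ?N {w \<in> space M. t < T w}"
    using B by (intro measure_Un_le) auto
  ultimately have "\<Omega> d t * (1 - (measure ?N {w \<in> space M. D w < d} + measure ?N {w \<in> space M. t < T w}))
      \<le> \<Omega> d t * measure ?N (space M - ?B)"
    using nonneg by (intro mult_left_mono) auto
  also have "\<dots> = (\<integral>w. \<Omega> d t * indicator (space M - ?B) w \<partial>?N)"
    by (simp add: Int_absorb2)
  also have "\<dots> \<le> \<Omega>bar a"
    unfolding \<Omega>bar_def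
  proof (rule integral_mono)
    show "integrable ?N (\<lambda>w. \<Omega> d t * indicator (space M - ?B) w)"
      using B by (intro integrable_mult_right integrable_real_indicator) (auto simp: N.emeasure_eq_measure)
    show "\<Omega> d t * indicator (space M - ?B) w \<le> \<Omega> (D w) (T w)" if "w \<in> space ?N" for w
      using that allocation_range[of w] assms by (auto simp: indicator_def intro!: allocation_mono)
  qed (rule allocation_integrable)
  finally show ?thesis .
qed

text \<open>Mirror image of the lower bound, except that the integrand is bounded by
  \<open>K\<close> on the exceptional event, which therefore multiplies its probability.\<close>

lemma mean_allocation_upper:
  assumes "0 \<le> d" "0 \<le> t"
  shows "\<Omega>bar a \<le> \<Omega> d t + K * (measure (given_state M A a) {w \<in> space M. d < D w} +
    measure (given_state M A a) {w \<in> space M. T w < t})"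
proof -
  let ?N = "given_state M A a"
  interpret N: prob_space ?N by (rule prob_space_given_state[OF a])
  let ?B = "{w \<in> space M. d < D w} \<union> {w \<in> space M. T w < t}"
  have [measurable]: "D \<in> borel_measurable M" "T \<in> borel_measurable M"
    by (fact demand(1)) (fact T_measurable)
  have B: "{w \<in> space M. d < D w} \<in> sets M" "{w \<in> space M. T w < t} \<in> sets M" "?B \<in> sets M"
    by measurable
  have nonneg: "0 \<le> \<Omega> d t" using \<Omega> assms by (auto simp: allocation_function_def)
  have int: "integrable ?N (\<lambda>w. K * indicator ?B w)"
    using B by (intro integrable_mult_right integrable_real_indicator) (auto simp: N.emeasure_eq_measure)
  have "\<Omega>bar a \<le> (\<integral>w. \<Omega> d t + K * indicator ?B w \<partial>?N)"
    unfolding \<Omega>bar_def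
  proof (rule integral_mono)
    show "integrable ?N (\<lambda>w. \<Omega> d t + K * indicator ?B w)"
      using int by simp
    show "\<Omega> (D w) (T w) \<le> \<Omega> d t + K * indicator ?B w" if "w \<in> space ?N" for w
      using that allocation_range[of w] assms nonneg demand(2)[of w] allocation_mono[of "D w" d t "T w"]
      by (auto simp: indicator_def)
  qed (rule allocation_integrable)
  also have "\<dots> = \<Omega> d t + K * measure ?N ?B"
    using int N.prob_space by (subst Bochner_Integration.integral_add) (auto simp: Int_absorb2)
  also have "\<dots> \<le> \<Omega> d t + K * (measure ?N {w \<in> space M. d < D w} + measure ?N {w \<in> space M. T w < t})"
    using B order_trans[OF nonneg K[OF assms]]
    by (intro add_left_mono mult_left_mono measure_Un_le) auto
  finally show ?thesis .
qed

end

context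
  fixes a p z
  assumes a: "a \<in> set_pmf \<rho>" and payments: "\<pi> = perturbed_payment p z" and z: "0 < z" "z < p"
    and n: "0 < n"
begin

lemma AE_two_payments: "AE w in given_state M A a. \<forall>i<n. P i w = p + z \<or> P i w = p - z"
proof -
  have "AE w in given_state M A a. \<forall>i\<in>{..<n}. P i w = p + z \<or> P i w = p - z"
    using AE_perturbed_payment[of p z] payments by (intro AE_finite_allI AE_payment[OF a]) auto
  then show ?thesis by (simp add: Ball_def)
qed

lemma payment_concentration:
  assumes h: "h \<in> borel_measurable borel" "\<And>y. \<bar>h y\<bar> \<le> 1" and \<delta>: "0 < \<delta>"
  shows "measure (given_state M A a)
    {w \<in> space M. \<delta> \<le> \<bar>(\<Sum>i<n. h (P i w)) / real n - (h (p + z) + h (p - z)) / 2\<bar>} \<le> 1 / (real n * \<delta>\<^sup>2)"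
proof -
  let ?e = "(h (p + z) + h (p - z)) / 2"
  interpret N: prob_space "given_state M A a" by (rule prob_space_given_state[OF a])
  interpret nu: prob_space "\<nu> a" using feature_law[OF a] by simp
  have moment: "(\<integral>w. (\<Prod>i\<in>J. h (P i w)) \<partial>given_state M A a) = ?e ^ card J" if "J \<subseteq> {..<n}" for J
    using product_moment[OF a that, of "\<lambda>x. h (snd x)"] h nu.prob_space
    by (simp add: payments integral_perturbed_payment)
  have "measure (given_state M A a) {w \<in> space (given_state M A a). \<delta> \<le> \<bar>(\<Sum>i<n. h (P i w)) / real n - ?e\<bar>}
      \<le> 1 / (real n * \<delta>\<^sup>2)"
  proof (rule N.weak_law_bound[OF n \<delta>])
    show "(\<lambda>w. h (P i w)) \<in> borel_measurable (given_state M A a)" if "i < n" for i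
      using measurable_compose[OF payment[OF that] h(1)] by simp
    show "N.expectation (\<lambda>w. h (P i w)) = ?e" if "i < n" for i
      using moment[of "{i}"] that by simp
    show "N.expectation (\<lambda>w. h (P i w) * h (P j w)) = ?e\<^sup>2" if "i < n" "j < n" "i \<noteq> j" for i j
    proof -
      have "{i, j} \<subseteq> {..<n}" "card {i, j} = 2"
        "\<And>w. (\<Prod>k\<in>{i, j}. h (P k w)) = h (P i w) * h (P j w)"
        using that by auto
      then show ?thesis using moment[of "{i, j}"] by (simp only:)
    qed
  qed (rule h(2))
  then show ?thesis by simp
qed

text \<open>The weight \<open>h\<close> is a function of the payment, so one statement covers both
  averages: \<open>h = 1\<close> yields participation, the sign of \<open>y - p\<close> yields its
  interaction with the perturbation.\<close>

lemma choice_concentration: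
  assumes f: "choice_functions \<B> f" and X: "0 \<le> \<Omega>bar a"
    and h: "h \<in> borel_measurable borel" "\<And>y. \<bar>h y\<bar> \<le> 1" and \<delta>: "0 < \<delta>"
  shows "measure (given_state M A a)
    {w \<in> space M. \<delta> \<le> \<bar>(\<Sum>i<n. Z i w * h (P i w)) / real n -
      (mean_choice f (\<nu> a) ((p + z) * \<Omega>bar a) * h (p + z) +
       mean_choice f (\<nu> a) ((p - z) * \<Omega>bar a) * h (p - z)) / 2\<bar>} \<le> 1 / (real n * \<delta>\<^sup>2)"
proof -
  let ?N = "given_state M A a" and ?X = "\<Omega>bar a"
  let ?e = "(mean_choice f (\<nu> a) ((p + z) * ?X) * h (p + z) + mean_choice f (\<nu> a) ((p - z) * ?X) * h (p - z)) / 2"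
  interpret N: prob_space ?N by (rule prob_space_given_state[OF a])
  interpret nu: choice_law "\<nu> a" \<B> f
    using feature_law[OF a] f by (simp add: choice_law_def choice_law_axioms_def)
  \<comment> \<open>Only two sections of \<open>f\<close> occur, so \<open>\<psi>\<close> is jointly
    measurable by construction. Assigning the value at \<open>p - z\<close> to all \<open>y\<close>
    other than \<open>p + z\<close> changes nothing almost surely.\<close>
  define \<psi> where "\<psi> = (\<lambda>(b, y). if y = p + z then f b ((p + z) * ?X) else f b ((p - z) * ?X))"
  have pos: "0 \<le> (p + z) * ?X" "0 \<le> (p - z) * ?X" using z X by auto
  have [measurable]: "(\<lambda>b. f b ((p + z) * ?X)) \<in> borel_measurable \<B>" "(\<lambda>b. f b ((p - z) * ?X)) \<in> borel_measurable \<B>"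
    using f pos by (auto simp: choice_functions_def)
  have \<psi>: "\<psi> \<in> borel_measurable (\<B> \<Otimes>\<^sub>M borel)"
    unfolding \<psi>_def by measurable
  have \<psi>_le: "\<bar>\<psi> (b, y)\<bar> \<le> 1" if "b \<in> space \<B>" for b y
    using that nu.f_range[OF _ pos(1), of b] nu.f_range[OF _ pos(2), of b] by (auto simp: \<psi>_def nu.space_eq)
  have \<psi>_eq: "AE y in \<pi>. \<forall>b\<in>space \<B>. f b (y * ?X) = \<psi> (b, y)"
    unfolding payments using AE_perturbed_payment by eventually_elim (auto simp: \<psi>_def)
  have "(\<integral>y. \<psi> (b, y) * h y \<partial>\<pi>) = (f b ((p + z) * ?X) * h (p + z) + f b ((p - z) * ?X) * h (p - z)) / 2" for b
    unfolding payments \<psi>_def using h(1) z(1) by (subst integral_perturbed_payment; simp)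
  then have "(\<integral>b. \<integral>y. \<psi> (b, y) * h y \<partial>\<pi> \<partial>\<nu> a) = ?e"
    using pos by (simp only:) (simp add: mean_choice_def nu.f_integrable)
  then have moment: "(\<integral>w. (\<Prod>i\<in>J. Z i w * h (P i w)) \<partial>?N) = ?e ^ card J" if "J \<subseteq> {..<n}" for J
    using choice_moment[OF a that \<psi> \<psi>_le \<psi>_eq h] by (simp only:)
  have "measure ?N {w \<in> space ?N. \<delta> \<le> \<bar>(\<Sum>i<n. Z i w * h (P i w)) / real n - ?e\<bar>} \<le> 1 / (real n * \<delta>\<^sup>2)"
  proof (rule N.weak_law_bound[OF n \<delta>])
    show "(\<lambda>w. Z i w * h (P i w)) \<in> borel_measurable ?N" if "i < n" for i
      using measurable_compose[OF payment[OF that] h(1)] active(1)[OF that] by simp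
    show "\<bar>Z i w * h (P i w)\<bar> \<le> 1" if "i < n" "w \<in> space ?N" for i w
      using active(2)[OF that(1), of w] that(2) h(2) by auto
    show "N.expectation (\<lambda>w. Z i w * h (P i w)) = ?e" if "i < n" for i
      using moment[of "{i}"] that by simp
    show "N.expectation (\<lambda>w. Z i w * h (P i w) * (Z j w * h (P j w))) = ?e\<^sup>2" if "i < n" "j < n" "i \<noteq> j" for i j
    proof -
      have "{i, j} \<subseteq> {..<n}" "card {i, j} = 2"
        "\<And>w. (\<Prod>k\<in>{i, j}. Z k w * h (P k w)) = Z i w * h (P i w) * (Z j w * h (P j w))"
        using that by auto
      then show ?thesis using moment[of "{i, j}"] by (simp only:)
    qed
  qed
  then show ?thesis by simp
qed

end

end

section \<open>Limits along the sequence of markets\<close>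

text \<open>Turns a product neighbourhood into a box: the distance of two tuples is at most the sum
  of the five coordinate distances, hence a fifth of the radius for each.\<close>

lemma continuous_in_five_arguments:
  fixes H :: "real \<Rightarrow> real \<Rightarrow> real \<Rightarrow> real \<Rightarrow> real \<Rightarrow> real"
  assumes "((\<lambda>(x1, x2, x3, x4, x5). H x1 x2 x3 x4 x5) \<longlongrightarrow> c) (nhds (a1, a2, a3, a4, a5))" "0 < \<epsilon>"
  obtains \<delta> where "0 < \<delta>"
    "\<And>x1 x2 x3 x4 x5. \<bar>x1 - a1\<bar> < \<delta> \<Longrightarrow> \<bar>x2 - a2\<bar> < \<delta> \<Longrightarrow> \<bar>x3 - a3\<bar> < \<delta> \<Longrightarrow> \<bar>x4 - a4\<bar> < \<delta> \<Longrightarrow>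
       \<bar>x5 - a5\<bar> < \<delta> \<Longrightarrow> \<bar>H x1 x2 x3 x4 x5 - c\<bar> < \<epsilon>"
proof -
  have dist_Pair_le: "dist (a, b) (c, d) \<le> dist a c + dist b d"
    for a c :: "'x::metric_space" and b d :: "'y::metric_space"
    unfolding dist_Pair_Pair by (rule sqrt_sum_squares_le_sum) auto
  from tendstoD[OF assms] obtain e where e: "0 < e"
    "\<And>x. dist x (a1, a2, a3, a4, a5) < e \<Longrightarrow> dist (case x of (x1, x2, x3, x4, x5) \<Rightarrow> H x1 x2 x3 x4 x5) c < \<epsilon>"
    by (auto simp: eventually_nhds_metric)
  show ?thesis
  proof (rule that[of "e / 5"])
    fix x1 x2 x3 x4 x5
    assume "\<bar>x1 - a1\<bar> < e / 5" "\<bar>x2 - a2\<bar> < e / 5" "\<bar>x3 - a3\<bar> < e / 5" "\<bar>x4 - a4\<bar> < e / 5" "\<bar>x5 - a5\<bar> < e / 5"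
    moreover have "dist (x1, x2, x3, x4, x5) (a1, a2, a3, a4, a5) \<le>
        dist x1 a1 + (dist x2 a2 + (dist x3 a3 + (dist x4 a4 + dist x5 a5)))"
      by (intro order_trans[OF dist_Pair_le] add_left_mono order_refl)
    ultimately have "dist (x1, x2, x3, x4, x5) (a1, a2, a3, a4, a5) < e"
      by (simp add: dist_real_def)
    from e(2)[OF this] show "\<bar>H x1 x2 x3 x4 x5 - c\<bar> < \<epsilon>"
      by (simp add: dist_real_def)
  qed (use e in simp)
qed

text \<open>The squares of signs are \<open>1\<close>, so the centred sum of squares is
  \<open>n * (1 - m\<^sup>2)\<close> with mean sign \<open>m = z * v\<close>. The scaling by
  \<open>z\<close> is chosen so that \<open>u\<close> and \<open>v\<close> stay convergent in the
  experiment and the slope depends continuously on them. If all signs agree, both sides are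
  \<open>0\<close> by \<open>x / 0 = 0\<close>.\<close>

lemma Delta_hat_signs:
  fixes Z e :: "nat \<Rightarrow> real" and z :: real
  assumes n: "0 < n" and z: "0 < z" and e: "\<And>i. i < n \<Longrightarrow> e i = 1 \<or> e i = - 1"
  defines "u \<equiv> (\<Sum>i<n. Z i * e i) / real n / z" and "v \<equiv> (\<Sum>i<n. e i) / real n / z"
  shows "Delta_hat n z Z e = (u - average n Z * v) / (1 - (z * v)\<^sup>2)"
proof -
  let ?C = "(\<Sum>i<n. Z i * e i) / real n" and ?e = "average n e" and ?Z = "average n Z"
  have sums: "(\<Sum>i<n. Z i) = real n * ?Z" "(\<Sum>i<n. e i) = real n * ?e"
    using n by (auto simp: average_def)
  have "(\<Sum>i<n. (Z i - ?Z) * (e i - ?e)) = (\<Sum>i<n. Z i * e i) - ?e * (\<Sum>i<n. Z i) - ?Z * (\<Sum>i<n. e i) + real n * (?Z * ?e)"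
    by (simp add: algebra_simps sum.distrib sum_subtractf sum_distrib_left sum_distrib_right)
  also have "\<dots> = real n * (?C - ?Z * ?e)"
    unfolding sums using n by (simp add: right_diff_distrib)
  finally have num: "(\<Sum>i<n. (Z i - ?Z) * (e i - ?e)) = real n * (?C - ?Z * ?e)" .
  have "(e i)\<^sup>2 = 1" if "i < n" for i using e[OF that] by auto
  then have "(\<Sum>i<n. (e i - ?e)\<^sup>2) = (\<Sum>i<n. 1 - 2 * ?e * e i + ?e\<^sup>2)"
    by (intro sum.cong) (auto simp: power2_diff)
  also have "\<dots> = real n - 2 * ?e * (\<Sum>i<n. e i) + real n * ?e\<^sup>2"
    by (simp add: sum.distrib sum_subtractf sum_distrib_left)
  also have "\<dots> = real n * (1 - ?e\<^sup>2)"
    unfolding sums by (simp add: algebra_simps power2_eq_square)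
  finally have den: "(\<Sum>i<n. (e i - ?e)\<^sup>2) = real n * (1 - ?e\<^sup>2)" .
  have v: "?e = z * v" and u: "?C = z * u"
    using z by (auto simp: u_def v_def average_def)
  have "real n * (z * u - ?Z * (z * v)) = real n * (z * (u - ?Z * v))" by (simp add: algebra_simps)
  then show ?thesis unfolding Delta_hat_def num den unfolding u v using n z by simp
qed

section \<open>Experiments with shrinking perturbations\<close>

locale local_experiment =
  fixes M :: "nat \<Rightarrow> 'w measure"
    and \<rho> :: "'a pmf"
    and \<B> :: "'b measure"
    and \<nu> :: "'a \<Rightarrow> 'b measure"
    and f :: "'b \<Rightarrow> real \<Rightarrow> real"
    and \<omega> r :: "real \<Rightarrow> real"
    and \<Omega> :: "real \<Rightarrow> real \<Rightarrow> real"
    and d :: "'a \<Rightarrow> real"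
    and A :: "nat \<Rightarrow> 'w \<Rightarrow> 'a"
    and D :: "nat \<Rightarrow> 'w \<Rightarrow> real"
    and B :: "nat \<Rightarrow> nat \<Rightarrow> 'w \<Rightarrow> 'b"
    and Z S eps :: "nat \<Rightarrow> nat \<Rightarrow> 'w \<Rightarrow> real"
    and p \<zeta> \<alpha> :: real
    and \<zeta>n :: "nat \<Rightarrow> real"
  assumes p: "0 < p" and \<zeta>: "0 < \<zeta>" "\<zeta> < p" and \<alpha>: "0 < \<alpha>" "\<alpha> < 1 / 2"
    and \<zeta>n: "\<And>n. \<zeta>n n = \<zeta> * real n powr (- \<alpha>)"
    and finite_states: "finite (set_pmf \<rho>)"
    and \<Omega>: "allocation_function \<omega> \<Omega>"
    and f: "choice_functions \<B> f"
    and r: "smooth_half r"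
    and markets: "\<And>n. n \<ge> 1 \<Longrightarrow>
      market (M n) n \<rho> \<B> \<nu> (perturbed_payment p (\<zeta>n n)) f \<Omega>
        (A n) (D n) (B n) (\<lambda>i w. p + \<zeta>n n * eps n i w) (Z n) (S n)"
    and demand: "\<And>a. a \<in> set_pmf \<rho> \<Longrightarrow> demand_scaling M A D a (d a)"
    and balanced: "\<And>a. a \<in> set_pmf \<rho> \<Longrightarrow> \<exists>!\<mu>. balanced f \<omega> (\<nu> a) (d a) p \<mu>"
begin

lemma \<zeta>n_tendsto: "\<zeta>n \<longlonglongrightarrow> 0"
proof -
  have "(\<lambda>n. \<zeta> * real n powr (- \<alpha>)) \<longlonglongrightarrow> \<zeta> * 0"
    using \<alpha> by (intro tendsto_intros tendsto_neg_powr filterlim_real_sequentially) auto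
  then show ?thesis by (simp add: \<zeta>n[abs_def])
qed

lemma \<zeta>n_nonneg: "0 \<le> \<zeta>n n"
  using \<zeta> by (simp add: \<zeta>n)

lemma \<zeta>n_range:
  assumes "1 \<le> n"
  shows "0 < \<zeta>n n" "\<zeta>n n < p"
proof -
  show "0 < \<zeta>n n" using assms \<zeta> by (simp add: \<zeta>n)
  have "real n powr (- \<alpha>) \<le> real n powr 0" using assms \<alpha> by (intro powr_mono) auto
  then have "\<zeta> * real n powr (- \<alpha>) \<le> \<zeta> * 1" using \<zeta> assms by (intro mult_left_mono) auto
  then show "\<zeta>n n < p" using \<zeta> unfolding \<zeta>n by linarith
qed

text \<open>At the scale of the perturbation the Chebyshev bound is of order
  \<open>n powr (2 * \<alpha> - 1)\<close>; \<open>\<alpha> < 1 / 2\<close> makes the exponent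
  negative.\<close>

lemma concentration_rate:
  assumes "0 < \<delta>"
  shows "(\<lambda>n. 1 / (real n * (\<delta> * \<zeta>n n)\<^sup>2)) \<longlonglongrightarrow> 0"
proof -
  have "(\<lambda>n. 1 / (\<delta> * \<zeta>)\<^sup>2 * real n powr (2 * \<alpha> - 1)) \<longlonglongrightarrow> 1 / (\<delta> * \<zeta>)\<^sup>2 * 0"
    using \<alpha> by (intro tendsto_intros tendsto_neg_powr filterlim_real_sequentially) auto
  moreover have "\<forall>\<^sub>F n in sequentially.
      1 / (\<delta> * \<zeta>)\<^sup>2 * real n powr (2 * \<alpha> - 1) = 1 / (real n * (\<delta> * \<zeta>n n)\<^sup>2)"
    using eventually_gt_at_top[of 0]
  proof eventually_elim
    case (elim n)
    have "(real n powr (- \<alpha>))\<^sup>2 = real n powr (- (2 * \<alpha>))"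
      by (simp add: power2_eq_square flip: powr_add)
    moreover have "real n powr (2 * \<alpha> - 1) * (real n powr 1 * real n powr (- (2 * \<alpha>))) = 1"
      unfolding powr_add[symmetric] using elim by simp
    ultimately have "real n powr (2 * \<alpha> - 1) = 1 / (real n * (real n powr (- \<alpha>))\<^sup>2)"
      using elim by (simp add: eq_divide_eq)
    then show ?case by (simp add: \<zeta>n power_mult_distrib)
  qed
  ultimately show ?thesis by (simp add: Lim_transform_eventually)
qed

lemma concentration_rate_fixed: "(\<lambda>n. 1 / (real n * \<delta>\<^sup>2)) \<longlonglongrightarrow> 0"
proof -
  have "(\<lambda>n. 1 / \<delta>\<^sup>2 * (1 / real n)) \<longlonglongrightarrow> 1 / \<delta>\<^sup>2 * 0"
    by (intro tendsto_intros lim_1_over_n)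
  then show ?thesis by (simp add: mult.commute)
qed

context
  fixes a \<mu>
  assumes a: "a \<in> set_pmf \<rho>" and \<mu>: "balanced f \<omega> (\<nu> a) (d a) p \<mu>"
begin

abbreviation "N n \<equiv> given_state (M n) (A n) a"
definition "active n w = (\<Sum>i<n. Z n i w)"
text \<open>Markets are given for \<open>n \<ge> 1\<close>; the value \<open>0\<close> at
  \<open>n = 0\<close> keeps \<open>X\<close> nonnegative at every index, as the limit lemmas
  ask.\<close>

definition "X n = (if n = 0 then 0 else \<integral>w. \<Omega> (D n w) (active n w) \<partial>N n)"

lemma mean_field_state: "mean_field_revenue (\<nu> a) \<B> f \<omega> (d a) p \<mu> r"
proof -
  show ?thesis
    using market.feature_law[OF markets[of 1] a] f \<Omega> demand[OF a] p \<mu> r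
    unfolding mean_field_revenue_def mean_field_revenue_axioms_def mean_field_def mean_field_axioms_def
      choice_law_def choice_law_axioms_def
    by (auto simp: allocation_function_def demand_scaling_def)
qed

interpretation mf: mean_field_revenue "\<nu> a" \<B> f \<omega> "d a" p \<mu> r
  by (rule mean_field_state)

lemma N_finite: "1 \<le> n \<Longrightarrow> prob_space (N n)"
  by (rule market.prob_space_given_state[OF markets a])

lemma N_sets: "sets (N n) = sets (M n)" and N_space: "space (N n) = space (M n)"
  by (simp_all add: given_state_def)

lemma X_nonneg: "0 \<le> X n"
proof (cases "n = 0")
  case False
  obtain K where "\<And>d t. 0 \<le> d \<Longrightarrow> 0 \<le> t \<Longrightarrow> \<Omega> d t \<le> K" using allocation_bounded[OF \<Omega>] by blast
  from market.mean_allocation_nonneg[OF markets \<Omega> a this, of n] show ?thesis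
    using False by (simp add: X_def active_def)
qed (simp add: X_def)

lemma active_concentration:
  assumes "1 \<le> n" "0 < \<delta>"
  shows "measure (N n) {w \<in> space (M n). \<delta> \<le> \<bar>active n w / real n - mf.rate_at (\<zeta>n n) (X n)\<bar>} \<le> 1 / (real n * \<delta>\<^sup>2)"
proof -
  show ?thesis
    using market.choice_concentration[OF markets[OF assms(1)] a refl \<zeta>n_range[OF assms(1)] _ f _ _ _ assms(2), of "\<lambda>_. 1"] X_nonneg[of n] assms(1)
    by (simp add: X_def active_def mf.rate_at_def)
qed

text \<open>\<open>eps\<close> is a sign only almost surely, and concentration is available for
  bounded functions of the payment. So the sign is recovered from the payment minus
  \<open>p\<close>, as \<open>sgn (\<zeta>n n * eps n i w)\<close>, which is bounded
  everywhere.\<close>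

lemma interaction_concentration:
  assumes "1 \<le> n" "0 < \<delta>"
  shows "measure (N n) {w \<in> space (M n). \<delta> \<le> \<bar>(\<Sum>i<n. Z n i w * sgn (\<zeta>n n * eps n i w)) / real n -
      (mf.g ((p + \<zeta>n n) * X n) - mf.g ((p - \<zeta>n n) * X n)) / 2\<bar>} \<le> 1 / (real n * \<delta>\<^sup>2)"
proof -
  have "(\<lambda>y. sgn (y - p)) \<in> borel_measurable borel" "\<bar>sgn (y - p)\<bar> \<le> 1" for y :: real
    by (auto simp: sgn_if)
  then show ?thesis
    using market.choice_concentration[OF markets[OF assms(1)] a refl \<zeta>n_range[OF assms(1)] _ f _ _ _ assms(2), of "\<lambda>y. sgn (y - p)"]
      X_nonneg[of n] assms(1) \<zeta>n_range[OF assms(1)]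
    by (simp add: X_def active_def)
qed

lemma sign_concentration:
  assumes "1 \<le> n" "0 < \<delta>"
  shows "measure (N n) {w \<in> space (M n). \<delta> \<le> \<bar>(\<Sum>i<n. sgn (\<zeta>n n * eps n i w)) / real n\<bar>} \<le> 1 / (real n * \<delta>\<^sup>2)"
proof -
  have "(\<lambda>y. sgn (y - p)) \<in> borel_measurable borel" "\<bar>sgn (y - p)\<bar> \<le> 1" for y :: real
    by (auto simp: sgn_if)
  then show ?thesis
    using market.payment_concentration[OF markets[OF assms(1)] a refl \<zeta>n_range[OF assms(1)] _ _ _ assms(2), of "\<lambda>y. sgn (y - p)"]
      assms(1) \<zeta>n_range[OF assms(1)]
    by simp
qed

lemma AE_signs:
  assumes "1 \<le> n"
  shows "AE w in N n. \<forall>i<n. eps n i w = 1 \<or> eps n i w = - 1"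
proof -
  have "AE w in N n. \<forall>i<n. p + \<zeta>n n * eps n i w = p + \<zeta>n n \<or> p + \<zeta>n n * eps n i w = p - \<zeta>n n"
    using market.AE_two_payments[OF markets[OF assms] a refl \<zeta>n_range[OF assms]] assms by simp
  then show ?thesis
  proof eventually_elim
    case (elim w)
    show ?case
    proof (intro allI impI)
      fix i assume "i < n"
      with elim have "\<zeta>n n * eps n i w = \<zeta>n n * 1 \<or> \<zeta>n n * eps n i w = \<zeta>n n * (- 1)" by auto
      then show "eps n i w = 1 \<or> eps n i w = - 1"
        using \<zeta>n_range(1)[OF assms] by (simp only: mult_cancel_left) auto
    qed
  qed
qed

lemma demand_measurable: "1 \<le> n \<Longrightarrow> D n \<in> borel_measurable (M n)"
  using market.demand(1)[OF markets] .

lemma active_measurable: "1 \<le> n \<Longrightarrow> active n \<in> borel_measurable (M n)"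
  using market.active(1)[OF markets] unfolding active_def by (intro borel_measurable_sum) auto

text \<open>Markov's inequality for the squared deviation, kept in the extended nonnegative reals in
  which the second moment is given.\<close>

lemma demand_concentration:
  assumes "0 < \<eta>"
  shows "(\<lambda>n. measure (N n) {w \<in> space (M n). \<eta> \<le> \<bar>D n w / real n - d a\<bar>}) \<longlonglongrightarrow> 0"
proof -
  let ?E = "\<lambda>n. {w \<in> space (M n). \<eta> \<le> \<bar>D n w / real n - d a\<bar>}"
  let ?I = "\<lambda>n. \<integral>\<^sup>+w. ennreal ((D n w / real n - d a)\<^sup>2) \<partial>N n"
  have I: "?I \<longlonglongrightarrow> 0" using demand[OF a] by (simp add: demand_scaling_def)
  have "emeasure (N n) (?E n) \<le> ennreal (1 / \<eta>\<^sup>2) * ?I n" if n: "1 \<le> n" for n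
  proof -
    have [measurable]: "D n \<in> borel_measurable (N n)"
      using demand_measurable[OF n] measurable_cong_sets[OF N_sets refl] by blast
    have "?E n = {w \<in> space (N n). 1 \<le> ennreal (1 / \<eta>\<^sup>2) * ennreal ((D n w / real n - d a)\<^sup>2)}"
    proof -
      have "\<eta> \<le> \<bar>x\<bar> \<longleftrightarrow> 1 \<le> ennreal (1 / \<eta>\<^sup>2) * ennreal (x\<^sup>2)" for x
      proof -
        have "\<eta> \<le> \<bar>x\<bar> \<longleftrightarrow> \<eta>\<^sup>2 \<le> x\<^sup>2" using assms by (simp flip: abs_le_square_iff)
        also have "\<dots> \<longleftrightarrow> 1 \<le> ennreal (1 / \<eta>\<^sup>2 * x\<^sup>2)" using assms by (simp add: field_simps)
        also have "ennreal (1 / \<eta>\<^sup>2 * x\<^sup>2) = ennreal (1 / \<eta>\<^sup>2) * ennreal (x\<^sup>2)"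
          by (rule ennreal_mult) simp_all
        finally show ?thesis .
      qed
      then show ?thesis by (simp add: N_space)
    qed
    also have "emeasure (N n) \<dots> \<le> ennreal (1 / \<eta>\<^sup>2) * (\<integral>\<^sup>+w. ennreal ((D n w / real n - d a)\<^sup>2) * indicator (space (N n)) w \<partial>N n)"
      using nn_integral_Markov_inequality[of "\<lambda>w. ennreal ((D n w / real n - d a)\<^sup>2)" "space (N n)" "N n" "ennreal (1 / \<eta>\<^sup>2)"]
      by simp
    also have "\<dots> = ennreal (1 / \<eta>\<^sup>2) * ?I n"
      by (intro arg_cong2[where f = "(*)"] refl nn_integral_cong) simp
    finally show ?thesis .
  qed
  then have upper: "\<forall>\<^sub>F n in sequentially. emeasure (N n) (?E n) \<le> ennreal (1 / \<eta>\<^sup>2) * ?I n"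
    by (auto simp: eventually_sequentially)
  have lower: "\<forall>\<^sub>F n in sequentially. 0 \<le> emeasure (N n) (?E n)"
    by simp
  have "(\<lambda>n. ennreal (1 / \<eta>\<^sup>2) * ?I n) \<longlonglongrightarrow> ennreal (1 / \<eta>\<^sup>2) * 0"
    by (rule ennreal_tendsto_cmult[OF _ I]) simp
  then have lim: "(\<lambda>n. ennreal (1 / \<eta>\<^sup>2) * ?I n) \<longlonglongrightarrow> 0"
    by simp
  have "(\<lambda>n. emeasure (N n) (?E n)) \<longlonglongrightarrow> 0"
    by (rule tendsto_sandwich[OF lower upper tendsto_const lim])
  then have "(\<lambda>n. emeasure (N n) (?E n)) \<longlonglongrightarrow> ennreal 0"
    by simp
  then show ?thesis
    unfolding measure_def by (rule tendsto_enn2real) simp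
qed

text \<open>If the rate lies \<open>\<delta>\<close> below \<open>m\<close>, then more than
  \<open>m * n\<close> active suppliers mean a deviation of at least \<open>\<delta>\<close>, which
  Chebyshev bounds by \<open>1 / (n * \<delta>\<^sup>2)\<close>. Demand is below
  \<open>(d a - \<eta>) * n\<close> with vanishing probability, so the mean allocation is bounded
  below by nearly its value on a ray.\<close>

lemma equilibrium_lower:
  assumes "0 < m" "0 < \<eta>" "\<eta> < d a" "0 < \<delta>" "0 < e"
  shows "\<forall>\<^sub>F n in sequentially. mf.rate_at (\<zeta>n n) (X n) + \<delta> \<le> m \<longrightarrow> \<omega> ((d a - \<eta>) / m) - e \<le> X n"
proof -
  obtain K where K: "\<And>d t. 0 \<le> d \<Longrightarrow> 0 \<le> t \<Longrightarrow> \<Omega> d t \<le> K" using allocation_bounded[OF \<Omega>] by blast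
  let ?s = "\<lambda>n. measure (N n) {w \<in> space (M n). \<eta> \<le> \<bar>D n w / real n - d a\<bar>} + 1 / (real n * \<delta>\<^sup>2)"
  let ?\<Omega> = "\<lambda>n. \<Omega> ((d a - \<eta>) * real n) (m * real n)"
  \<comment> \<open>This bound does not involve the rate, so the threshold for \<open>n\<close> is
    fixed before the premise of the implication is assumed.\<close>
  have "(\<lambda>n. ?\<Omega> n * (1 - ?s n)) \<longlonglongrightarrow> \<omega> ((d a - \<eta>) / m) * (1 - (0 + 0))"
    using assms by (intro tendsto_intros allocation_ray_limit[OF \<Omega>] demand_concentration concentration_rate_fixed) auto
  then have "\<forall>\<^sub>F n in sequentially. \<omega> ((d a - \<eta>) / m) - e < ?\<Omega> n * (1 - ?s n)"
    by (rule order_tendstoD) (use assms in simp)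
  then show ?thesis using eventually_ge_at_top[of 1]
  proof eventually_elim
    case (elim n)
    interpret N: prob_space "N n" using elim by (intro N_finite)
    show ?case
    proof
      assume small: "mf.rate_at (\<zeta>n n) (X n) + \<delta> \<le> m"
      note [measurable] = demand_measurable[OF elim(2)] active_measurable[OF elim(2)]
      have "measure (N n) {w \<in> space (M n). D n w < (d a - \<eta>) * real n}
          \<le> measure (N n) {w \<in> space (M n). \<eta> \<le> \<bar>D n w / real n - d a\<bar>}"
        using elim by (intro N.finite_measure_mono) (auto simp: N_sets field_simps)
      moreover have "measure (N n) {w \<in> space (M n). m * real n < active n w}
          \<le> measure (N n) {w \<in> space (M n). \<delta> \<le> \<bar>active n w / real n - mf.rate_at (\<zeta>n n) (X n)\<bar>}"
      proof (intro N.finite_measure_mono subsetI)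
        fix w assume "w \<in> {w \<in> space (M n). m * real n < active n w}"
        then have "w \<in> space (M n)" "m < active n w / real n" using elim by (auto simp: pos_less_divide_eq)
        then show "w \<in> {w \<in> space (M n). \<delta> \<le> \<bar>active n w / real n - mf.rate_at (\<zeta>n n) (X n)\<bar>}"
          using small by auto
      qed (simp add: N_sets)
      moreover have "0 \<le> ?\<Omega> n" using \<Omega> assms by (auto simp: allocation_function_def)
      ultimately have "?\<Omega> n * (1 - ?s n) \<le> ?\<Omega> n * (1 - (measure (N n) {w \<in> space (M n). D n w < (d a - \<eta>) * real n} +
          measure (N n) {w \<in> space (M n). m * real n < active n w}))"
        using active_concentration[OF elim(2) assms(4)] by (intro mult_left_mono) auto
      also have "\<dots> \<le> X n"
        using market.mean_allocation_lower[OF markets[OF elim(2)] \<Omega> a K, of "(d a - \<eta>) * real n" "m * real n"] assms elim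
        by (simp add: X_def active_def)
      finally show "\<omega> ((d a - \<eta>) / m) - e \<le> X n" using elim by simp
    qed
  qed
qed

lemma equilibrium_upper:
  assumes "0 < m" "0 < \<eta>" "\<eta> < d a" "0 < \<delta>" "0 < e"
  shows "\<forall>\<^sub>F n in sequentially. m \<le> mf.rate_at (\<zeta>n n) (X n) - \<delta> \<longrightarrow> X n \<le> \<omega> ((d a + \<eta>) / m) + e"
proof -
  obtain K where K: "\<And>d t. 0 \<le> d \<Longrightarrow> 0 \<le> t \<Longrightarrow> \<Omega> d t \<le> K" using allocation_bounded[OF \<Omega>] by blast
  \<comment> \<open>The sign of \<open>K\<close> matters because it multiplies probabilities that
    are enlarged below.\<close>
  have "0 \<le> \<Omega> 0 0" using \<Omega> by (auto simp: allocation_function_def)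
  then have K0: "0 \<le> K" using K[of 0 0] by simp
  let ?s = "\<lambda>n. measure (N n) {w \<in> space (M n). \<eta> \<le> \<bar>D n w / real n - d a\<bar>} + 1 / (real n * \<delta>\<^sup>2)"
  let ?\<Omega> = "\<lambda>n. \<Omega> ((d a + \<eta>) * real n) (m * real n)"
  have "(\<lambda>n. ?\<Omega> n + K * ?s n) \<longlonglongrightarrow> \<omega> ((d a + \<eta>) / m) + K * (0 + 0)"
    using assms by (intro tendsto_intros allocation_ray_limit[OF \<Omega>] demand_concentration concentration_rate_fixed) auto
  then have "\<forall>\<^sub>F n in sequentially. ?\<Omega> n + K * ?s n < \<omega> ((d a + \<eta>) / m) + e"
    by (rule order_tendstoD) (use assms in simp)
  then show ?thesis using eventually_ge_at_top[of 1]
  proof eventually_elim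
    case (elim n)
    interpret N: prob_space "N n" using elim by (intro N_finite)
    show ?case
    proof
      assume big: "m \<le> mf.rate_at (\<zeta>n n) (X n) - \<delta>"
      note [measurable] = demand_measurable[OF elim(2)] active_measurable[OF elim(2)]
      have "measure (N n) {w \<in> space (M n). (d a + \<eta>) * real n < D n w}
          \<le> measure (N n) {w \<in> space (M n). \<eta> \<le> \<bar>D n w / real n - d a\<bar>}"
        using elim by (intro N.finite_measure_mono) (auto simp: N_sets field_simps)
      moreover have "measure (N n) {w \<in> space (M n). active n w < m * real n}
          \<le> measure (N n) {w \<in> space (M n). \<delta> \<le> \<bar>active n w / real n - mf.rate_at (\<zeta>n n) (X n)\<bar>}"
      proof (intro N.finite_measure_mono subsetI)
        fix w assume "w \<in> {w \<in> space (M n). active n w < m * real n}"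
        then have "w \<in> space (M n)" "active n w / real n < m" using elim by (auto simp: pos_divide_less_eq)
        then show "w \<in> {w \<in> space (M n). \<delta> \<le> \<bar>active n w / real n - mf.rate_at (\<zeta>n n) (X n)\<bar>}"
          using big by auto
      qed (simp add: N_sets)
      ultimately have "K * (measure (N n) {w \<in> space (M n). (d a + \<eta>) * real n < D n w} +
          measure (N n) {w \<in> space (M n). active n w < m * real n}) \<le> K * ?s n"
        using active_concentration[OF elim(2) assms(4)] K0 by (intro mult_left_mono) auto
      moreover have "X n \<le> ?\<Omega> n + K * (measure (N n) {w \<in> space (M n). (d a + \<eta>) * real n < D n w} +
          measure (N n) {w \<in> space (M n). active n w < m * real n})"
        using market.mean_allocation_upper[OF markets[OF elim(2)] \<Omega> a K, of "(d a + \<eta>) * real n" "m * real n"] assms elim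
        by (simp add: X_def active_def)
      ultimately show "X n \<le> \<omega> ((d a + \<eta>) / m) + e" using elim by simp
    qed
  qed
qed

lemmas equilibrium_converges = mf.equilibrium_limit[OF \<zeta>n_tendsto \<zeta>n_nonneg X_nonneg equilibrium_lower equilibrium_upper]

lemma gradient_converges:
  "(\<lambda>n. (mf.g ((p + \<zeta>n n) * X n) - mf.g ((p - \<zeta>n n) * X n)) / 2 / \<zeta>n n) \<longlonglongrightarrow> mf.x\<^sub>0 * mf.slope"
proof (rule mf.slope_limit[OF \<zeta>n_tendsto _ X_nonneg equilibrium_converges(2)])
  show "\<forall>\<^sub>F n in sequentially. 0 < \<zeta>n n \<and> \<zeta>n n < p"
    using eventually_ge_at_top[of 1] by eventually_elim (use \<zeta>n_range in auto)
qed

abbreviation "estimate n w \<equiv>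
  Gamma_hat p \<omega> r (D n w / real n) (average n (\<lambda>i. Z n i w)) (Delta_hat n (\<zeta>n n) (\<lambda>i. Z n i w) (\<lambda>i. eps n i w))"

text \<open>Continuity is extracted as a deterministic \<open>\<delta>\<close>, so that any single
  path with five small deviations has a good estimate. At the limit point \<open>v\<close> and
  \<open>z\<close> are \<open>0\<close> and the denominator is \<open>1\<close>.\<close>

lemma Gamma_near:
  assumes "0 < \<epsilon>"
  obtains \<delta> where "0 < \<delta>"
    "\<And>Db Zb u v z. \<bar>Db - d a\<bar> < \<delta> \<Longrightarrow> \<bar>Zb - \<mu>\<bar> < \<delta> \<Longrightarrow> \<bar>u - mf.x\<^sub>0 * mf.slope\<bar> < \<delta> \<Longrightarrow> \<bar>v\<bar> < \<delta> \<Longrightarrow> \<bar>z\<bar> < \<delta> \<Longrightarrow>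
      \<bar>Gamma_hat p \<omega> r Db Zb ((u - Zb * v) / (1 - (z * v)\<^sup>2)) - deriv (mf_utility r f \<omega> (\<nu> a) (d a)) p\<bar> < \<epsilon>"
proof -
  let ?F = "nhds (d a, \<mu>, mf.x\<^sub>0 * mf.slope, 0::real, 0::real)"
  have Db: "(fst \<longlongrightarrow> d a) ?F"
    and Zb: "((\<lambda>x. fst (snd x)) \<longlongrightarrow> \<mu>) ?F"
    and u: "((\<lambda>x. fst (snd (snd x))) \<longlongrightarrow> mf.x\<^sub>0 * mf.slope) ?F"
    and v: "((\<lambda>x. fst (snd (snd (snd x)))) \<longlongrightarrow> 0) ?F"
    and z: "((\<lambda>x. snd (snd (snd (snd x)))) \<longlongrightarrow> 0) ?F"
    by (rule tendsto_eq_intros filterlim_ident refl | simp)+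
  have "((\<lambda>x. (fst (snd (snd x)) - fst (snd x) * fst (snd (snd (snd x)))) /
      (1 - (snd (snd (snd (snd x))) * fst (snd (snd (snd x))))\<^sup>2)) \<longlongrightarrow>
      (mf.x\<^sub>0 * mf.slope - \<mu> * 0) / (1 - (0 * 0)\<^sup>2)) ?F"
    by (intro tendsto_intros u v z Zb) simp
  then have "((\<lambda>x. (fst (snd (snd x)) - fst (snd x) * fst (snd (snd (snd x)))) /
      (1 - (snd (snd (snd (snd x))) * fst (snd (snd (snd x))))\<^sup>2)) \<longlongrightarrow> mf.x\<^sub>0 * mf.slope) ?F"
    by simp
  from mf.Gamma_tendsto[OF Db Zb this]
  have "((\<lambda>(Db, Zb, u, v, z). Gamma_hat p \<omega> r Db Zb ((u - Zb * v) / (1 - (z * v)\<^sup>2))) \<longlongrightarrow>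
      deriv (mf_utility r f \<omega> (\<nu> a) (d a)) p) ?F"
    by (simp only: case_prod_beta')
  from continuous_in_five_arguments[OF this assms] show ?thesis
    using that by (metis diff_zero)
qed

text \<open>The sets \<open>F n\<close> eventually cover the event of a bad estimate of the utility
  derivative of this state. As measurable sets that do not mention the random state, they are the
  form in which the states can be recombined.\<close>

lemma estimate_converges_in_state:
  assumes "0 < \<epsilon>"
  obtains F where "\<And>n. 1 \<le> n \<Longrightarrow> F n \<in> sets (M n)" "(\<lambda>n. measure (N n) (F n)) \<longlonglongrightarrow> 0"
    "\<forall>\<^sub>F n in sequentially. \<forall>w\<in>space (M n).
      \<bar>estimate n w - deriv (mf_utility r f \<omega> (\<nu> a) (d a)) p\<bar> > \<epsilon> \<longrightarrow> w \<in> F n"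
proof -
  obtain \<delta> where \<delta>: "0 < \<delta>"
    "\<And>Db Zb u v z. \<bar>Db - d a\<bar> < \<delta> \<Longrightarrow> \<bar>Zb - \<mu>\<bar> < \<delta> \<Longrightarrow> \<bar>u - mf.x\<^sub>0 * mf.slope\<bar> < \<delta> \<Longrightarrow> \<bar>v\<bar> < \<delta> \<Longrightarrow> \<bar>z\<bar> < \<delta> \<Longrightarrow>
      \<bar>Gamma_hat p \<omega> r Db Zb ((u - Zb * v) / (1 - (z * v)\<^sup>2)) - deriv (mf_utility r f \<omega> (\<nu> a) (d a)) p\<bar> < \<epsilon>"
    using Gamma_near[OF assms] by blast
  let ?c = "\<lambda>n. (mf.g ((p + \<zeta>n n) * X n) - mf.g ((p - \<zeta>n n) * X n)) / 2"
  let ?C = "\<lambda>n w. (\<Sum>i<n. Z n i w * sgn (\<zeta>n n * eps n i w)) / real n"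
  let ?v = "\<lambda>n w. (\<Sum>i<n. sgn (\<zeta>n n * eps n i w)) / real n"
  let ?q = "\<lambda>n. mf.rate_at (\<zeta>n n) (X n)"
  have "\<forall>n\<in>{1..}. \<exists>S. S \<in> null_sets (N n) \<and> {w \<in> space (M n). \<not> (\<forall>i<n. eps n i w = 1 \<or> eps n i w = - 1)} \<subseteq> S"
    using AE_signs unfolding eventually_ae_filter N_space by blast
  from bchoice[OF this] obtain F0 where "\<forall>n\<in>{1..}. F0 n \<in> null_sets (N n) \<and>
      {w \<in> space (M n). \<not> (\<forall>i<n. eps n i w = 1 \<or> eps n i w = - 1)} \<subseteq> F0 n" ..
  then have F0: "\<And>n. 1 \<le> n \<Longrightarrow> F0 n \<in> null_sets (N n)"
    "\<And>n. 1 \<le> n \<Longrightarrow> {w \<in> space (M n). \<not> (\<forall>i<n. eps n i w = 1 \<or> eps n i w = - 1)} \<subseteq> F0 n"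
    by simp_all
  \<comment> \<open>Where the centre is itself only close to its limit, half of
    \<open>\<delta>\<close> is kept for that distance; demand and mean sign have fixed centres.
    \<open>F3\<close> and \<open>F4\<close> carry the factor \<open>\<zeta>n n\<close> because their
    averages are later divided by it.\<close>
  define F1 where "F1 n = {w \<in> space (M n). \<delta> \<le> \<bar>D n w / real n - d a\<bar>}" for n
  define F2 where "F2 n = {w \<in> space (M n). \<delta> / 2 \<le> \<bar>active n w / real n - ?q n\<bar>}" for n
  define F3 where "F3 n = {w \<in> space (M n). \<delta> / 2 * \<zeta>n n \<le> \<bar>?C n w - ?c n\<bar>}" for n
  define F4 where "F4 n = {w \<in> space (M n). \<delta> * \<zeta>n n \<le> \<bar>?v n w\<bar>}" for n
  have sets: "F0 n \<in> sets (M n)" "F1 n \<in> sets (M n)" "F2 n \<in> sets (M n)" "F3 n \<in> sets (M n)" "F4 n \<in> sets (M n)"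
    if n: "1 \<le> n" for n
  proof -
    note [measurable] = demand_measurable[OF n] active_measurable[OF n]
    have sg: "(\<lambda>w. sgn (\<zeta>n n * eps n i w)) \<in> borel_measurable (M n)" if "i < n" for i
    proof -
      have "(\<lambda>w. sgn ((p + \<zeta>n n * eps n i w) - p)) \<in> borel_measurable (M n)"
        using market.payment[OF markets[OF n] that] by measurable
      then show ?thesis by simp
    qed
    have [measurable]: "?C n \<in> borel_measurable (M n)" "?v n \<in> borel_measurable (M n)"
      using market.active(1)[OF markets[OF n]] sg by (auto intro!: borel_measurable_divide borel_measurable_sum borel_measurable_times)
    show "F0 n \<in> sets (M n)" using F0(1)[OF n] N_sets by auto
    show "F1 n \<in> sets (M n)" "F2 n \<in> sets (M n)" "F3 n \<in> sets (M n)" "F4 n \<in> sets (M n)"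
      unfolding F1_def F2_def F3_def F4_def by measurable
  qed
  define F where "F n = F0 n \<union> (F1 n \<union> (F2 n \<union> (F3 n \<union> F4 n)))" for n
  show ?thesis
  proof (rule that[of F])
    show "F n \<in> sets (M n)" if "1 \<le> n" for n
      unfolding F_def using sets[OF that] by (intro sets.Un)
    have bound: "measure (N n) (F n) \<le> 0 + (measure (N n) (F1 n) + (1 / (real n * (\<delta> / 2)\<^sup>2) +
        (1 / (real n * (\<delta> / 2 * \<zeta>n n)\<^sup>2) + 1 / (real n * (\<delta> * \<zeta>n n)\<^sup>2))))" if n: "1 \<le> n" for n
    proof -
      note s = sets[OF n, folded N_sets]
      have \<delta>\<zeta>: "0 < \<delta> / 2 * \<zeta>n n" "0 < \<delta> * \<zeta>n n" using \<delta>(1) \<zeta>n_range[OF n] by auto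
      have "measure (N n) (F0 n) = 0"
        using F0(1)[OF n] by (simp add: measure_def null_setsD1)
      moreover have "measure (N n) (F n) \<le> measure (N n) (F0 n) + (measure (N n) (F1 n) + (measure (N n) (F2 n) +
          (measure (N n) (F3 n) + measure (N n) (F4 n))))"
        unfolding F_def using s
        by (intro order_trans[OF measure_Un_le] add_left_mono sets.Un order_refl)
      moreover have "measure (N n) (F2 n) \<le> 1 / (real n * (\<delta> / 2)\<^sup>2)"
        unfolding F2_def using \<delta>(1) by (intro active_concentration n) simp
      moreover have "measure (N n) (F3 n) \<le> 1 / (real n * (\<delta> / 2 * \<zeta>n n)\<^sup>2)"
        unfolding F3_def by (rule interaction_concentration[OF n \<delta>\<zeta>(1)])
      moreover have "measure (N n) (F4 n) \<le> 1 / (real n * (\<delta> * \<zeta>n n)\<^sup>2)"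
        unfolding F4_def by (rule sign_concentration[OF n \<delta>\<zeta>(2)])
      ultimately show ?thesis by linarith
    qed
    have "(\<lambda>n. 0 + (measure (N n) (F1 n) + (1 / (real n * (\<delta> / 2)\<^sup>2) +
        (1 / (real n * (\<delta> / 2 * \<zeta>n n)\<^sup>2) + 1 / (real n * (\<delta> * \<zeta>n n)\<^sup>2))))) \<longlonglongrightarrow> 0 + (0 + (0 + (0 + 0)))"
      unfolding F1_def using \<delta>(1)
      by (intro tendsto_add tendsto_const demand_concentration concentration_rate concentration_rate_fixed) auto
    then have lim: "(\<lambda>n. 0 + (measure (N n) (F1 n) + (1 / (real n * (\<delta> / 2)\<^sup>2) +
        (1 / (real n * (\<delta> / 2 * \<zeta>n n)\<^sup>2) + 1 / (real n * (\<delta> * \<zeta>n n)\<^sup>2))))) \<longlonglongrightarrow> 0" by (simp only: add_0)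
    have "\<forall>\<^sub>F n in sequentially. norm (measure (N n) (F n)) \<le> 0 + (measure (N n) (F1 n) + (1 / (real n * (\<delta> / 2)\<^sup>2) +
        (1 / (real n * (\<delta> / 2 * \<zeta>n n)\<^sup>2) + 1 / (real n * (\<delta> * \<zeta>n n)\<^sup>2))))"
      using eventually_ge_at_top[of 1] by (rule eventually_mono) (simp only: real_norm_def abs_of_nonneg measure_nonneg bound)
    then show "(\<lambda>n. measure (N n) (F n)) \<longlonglongrightarrow> 0"
      using lim by (rule Lim_null_comparison)
    have "\<forall>\<^sub>F n in sequentially. dist (?q n) \<mu> < \<delta> / 2"
      using \<delta>(1) by (intro tendstoD[OF equilibrium_converges(1)]) auto
    moreover have "\<forall>\<^sub>F n in sequentially. dist (?c n / \<zeta>n n) (mf.x\<^sub>0 * mf.slope) < \<delta> / 2"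
      using \<delta>(1) by (intro tendstoD[OF gradient_converges]) auto
    moreover have "\<forall>\<^sub>F n in sequentially. dist (\<zeta>n n) 0 < \<delta>"
      using \<delta>(1) by (intro tendstoD[OF \<zeta>n_tendsto])
    ultimately show "\<forall>\<^sub>F n in sequentially. \<forall>w\<in>space (M n).
      \<bar>estimate n w - deriv (mf_utility r f \<omega> (\<nu> a) (d a)) p\<bar> > \<epsilon> \<longrightarrow> w \<in> F n"
      using eventually_ge_at_top[of 1]
    proof eventually_elim
      case (elim n)
      show ?case
      proof (intro ballI impI, rule ccontr)
        fix w assume w: "w \<in> space (M n)" and far: "\<epsilon> < \<bar>estimate n w - deriv (mf_utility r f \<omega> (\<nu> a) (d a)) p\<bar>"
          and good: "w \<notin> F n"
        note z = \<zeta>n_range[OF elim(4)]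
        have signs: "eps n i w = 1 \<or> eps n i w = - 1" if "i < n" for i
          using F0(2)[OF elim(4)] good w that by (auto simp: F_def)
        then have sgn_eps: "sgn (\<zeta>n n * eps n i w) = eps n i w" if "i < n" for i
          using signs[OF that] z by auto
        have C: "?C n w = (\<Sum>i<n. Z n i w * eps n i w) / real n" and v: "?v n w = (\<Sum>i<n. eps n i w) / real n"
          using sgn_eps by simp_all
        have avg: "average n (\<lambda>i. Z n i w) = active n w / real n"
          by (simp add: average_def active_def)
        have "\<bar>D n w / real n - d a\<bar> < \<delta>"
          using good w by (auto simp: F_def F1_def)
        moreover have "\<bar>active n w / real n - \<mu>\<bar> < \<delta>"
        proof -
          have "\<bar>active n w / real n - ?q n\<bar> < \<delta> / 2" using good w by (simp add: F_def F2_def)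
          then show ?thesis using elim(1) unfolding dist_real_def by linarith
        qed
        moreover have "\<bar>?C n w / \<zeta>n n - mf.x\<^sub>0 * mf.slope\<bar> < \<delta>"
        proof -
          have "\<bar>?C n w - ?c n\<bar> < \<delta> / 2 * \<zeta>n n" using good w by (auto simp: F_def F3_def)
          then have "\<bar>?C n w - ?c n\<bar> / \<zeta>n n < \<delta> / 2" using z by (simp add: pos_divide_less_eq)
          moreover have "\<bar>?C n w / \<zeta>n n - ?c n / \<zeta>n n\<bar> = \<bar>?C n w - ?c n\<bar> / \<zeta>n n"
            unfolding diff_divide_distrib[symmetric] abs_divide using z by simp
          ultimately show ?thesis using elim(2) unfolding dist_real_def by linarith
        qed
        moreover have "\<bar>?v n w / \<zeta>n n\<bar> < \<delta>"
        proof -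
          have "\<bar>?v n w\<bar> < \<delta> * \<zeta>n n" using good w by (auto simp: F_def F4_def)
          then have "\<bar>?v n w\<bar> / \<zeta>n n < \<delta>" using z(1) by (simp only: pos_divide_less_eq)
          then show ?thesis unfolding abs_divide[of "?v n w"] using z(1) by (simp only: abs_of_pos)
        qed
        moreover have "\<bar>\<zeta>n n\<bar> < \<delta>" using elim(3) by (simp add: dist_real_def)
        ultimately have near: "\<bar>Gamma_hat p \<omega> r (D n w / real n) (active n w / real n)
            ((?C n w / \<zeta>n n - active n w / real n * (?v n w / \<zeta>n n)) / (1 - (\<zeta>n n * (?v n w / \<zeta>n n))\<^sup>2))
            - deriv (mf_utility r f \<omega> (\<nu> a) (d a)) p\<bar> < \<epsilon>"
          by (rule \<delta>(2))
        have Delta: "Delta_hat n (\<zeta>n n) (\<lambda>i. Z n i w) (\<lambda>i. eps n i w) =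
            (?C n w / \<zeta>n n - active n w / real n * (?v n w / \<zeta>n n)) / (1 - (\<zeta>n n * (?v n w / \<zeta>n n))\<^sup>2)"
          unfolding C v avg[symmetric] using elim(4) z(1) signs by (intro Delta_hat_signs) auto
        show False using far near unfolding Delta avg by linarith
      qed
    qed
  qed
qed

end

text \<open>Finitely many states allow a common threshold for \<open>n\<close> and a finite sum of
  vanishing bounds. The target depends on the random state, so each path is charged to the cover
  that belongs to its realised state.\<close>

theorem estimate_converges:
  assumes "0 < \<epsilon>"
  shows "(\<lambda>n. measure (M n) {w \<in> space (M n).
    \<bar>estimate n w - deriv (mf_utility r f \<omega> (\<nu> (A n w)) (d (A n w))) p\<bar> > \<epsilon>}) \<longlonglongrightarrow> 0"
proof -
  let ?E = "\<lambda>n. {w \<in> space (M n). \<bar>estimate n w - deriv (mf_utility r f \<omega> (\<nu> (A n w)) (d (A n w))) p\<bar> > \<epsilon>}"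
  let ?P = "\<lambda>a F. (\<forall>n\<ge>1. F n \<in> sets (M n)) \<and> (\<lambda>n. measure (given_state (M n) (A n) a) (F n)) \<longlonglongrightarrow> 0 \<and>
    (\<forall>\<^sub>F n in sequentially. \<forall>w\<in>space (M n).
      \<bar>estimate n w - deriv (mf_utility r f \<omega> (\<nu> a) (d a)) p\<bar> > \<epsilon> \<longrightarrow> w \<in> F n)"
  have "\<forall>a\<in>set_pmf \<rho>. \<exists>F. ?P a F"
  proof
    fix a assume a: "a \<in> set_pmf \<rho>"
    obtain \<mu> where "balanced f \<omega> (\<nu> a) (d a) p \<mu>" using balanced[OF a] by blast
    then show "\<exists>F. ?P a F" by (rule estimate_converges_in_state[OF a _ assms]) blast
  qed
  from bchoice[OF this] obtain F where "\<forall>a\<in>set_pmf \<rho>. ?P a (F a)" ..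
  then have F: "\<And>a n. a \<in> set_pmf \<rho> \<Longrightarrow> 1 \<le> n \<Longrightarrow> F a n \<in> sets (M n)"
    "\<And>a. a \<in> set_pmf \<rho> \<Longrightarrow> (\<lambda>n. measure (given_state (M n) (A n) a) (F a n)) \<longlonglongrightarrow> 0"
    "\<And>a. a \<in> set_pmf \<rho> \<Longrightarrow> \<forall>\<^sub>F n in sequentially. \<forall>w\<in>space (M n).
      \<bar>estimate n w - deriv (mf_utility r f \<omega> (\<nu> a) (d a)) p\<bar> > \<epsilon> \<longrightarrow> w \<in> F a n"
    by blast+
  have "\<forall>\<^sub>F n in sequentially. \<forall>a\<in>set_pmf \<rho>. \<forall>w\<in>space (M n).
      \<bar>estimate n w - deriv (mf_utility r f \<omega> (\<nu> a) (d a)) p\<bar> > \<epsilon> \<longrightarrow> w \<in> F a n"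
    by (intro eventually_ball_finite finite_states ballI F(3))
  then have "\<forall>\<^sub>F n in sequentially. norm (measure (M n) (?E n)) \<le>
      (\<Sum>a\<in>set_pmf \<rho>. measure (given_state (M n) (A n) a) (F a n))"
    using eventually_ge_at_top[of 1]
  proof eventually_elim
    case (elim n)
    show ?case
      using market.prob_le_sum_states[OF markets[OF elim(2)] finite_states, of "\<lambda>a. F a n" "?E n"] elim F(1)
      by auto
  qed
  moreover have "(\<lambda>n. \<Sum>a\<in>set_pmf \<rho>. measure (given_state (M n) (A n) a) (F a n)) \<longlonglongrightarrow> 0"
    using F(2) by (intro tendsto_null_sum)
  ultimately show ?thesis by (rule Lim_null_comparison)
qed

end

theorem theorem6:
  fixes M :: "nat \<Rightarrow> 'w measure"
    and \<rho> :: "'a pmf"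
    and \<B> :: "'b measure"
    and \<nu> :: "'a \<Rightarrow> 'b measure"
    and f :: "'b \<Rightarrow> real \<Rightarrow> real"
    and \<omega> r :: "real \<Rightarrow> real"
    and \<Omega> R :: "real \<Rightarrow> real \<Rightarrow> real"
    and d :: "'a \<Rightarrow> real"
    and A :: "nat \<Rightarrow> 'w \<Rightarrow> 'a"
    and D :: "nat \<Rightarrow> 'w \<Rightarrow> real"
    and B :: "nat \<Rightarrow> nat \<Rightarrow> 'w \<Rightarrow> 'b"
    and Z S eps :: "nat \<Rightarrow> nat \<Rightarrow> 'w \<Rightarrow> real"
    and p \<zeta> \<alpha> :: real
    and \<zeta>n :: "nat \<Rightarrow> real"
  assumes "0 < p" and "0 < \<zeta>" and "\<zeta> < p" and "0 < \<alpha>" and "\<alpha> < 1 / 2"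
    and "\<And>n. \<zeta>n n = \<zeta> * real n powr (- \<alpha>)"
    and "finite (set_pmf \<rho>)"
    and "allocation_function \<omega> \<Omega>"
    and "choice_functions \<B> f"
    and "revenue_function r R"
    and "\<And>n. n \<ge> 1 \<Longrightarrow>
      market (M n) n \<rho> \<B> \<nu> (perturbed_payment p (\<zeta>n n)) f \<Omega>
        (A n) (D n) (B n) (\<lambda>i w. p + \<zeta>n n * eps n i w) (Z n) (S n)"
    and "\<And>a. a \<in> set_pmf \<rho> \<Longrightarrow> demand_scaling M A D a (d a)"
    and "\<And>a. a \<in> set_pmf \<rho> \<Longrightarrow> \<exists>!\<mu>. balanced f \<omega> (\<nu> a) (d a) p \<mu>"
  shows "\<forall>\<epsilon>>0.
    (\<lambda>n. measure (M n) {w \<in> space (M n).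
       \<bar>Gamma_hat p \<omega> r (D n w / real n) (average n (\<lambda>i. Z n i w))
            (Delta_hat n (\<zeta>n n) (\<lambda>i. Z n i w) (\<lambda>i. eps n i w))
          - deriv (mf_utility r f \<omega> (\<nu> (A n w)) (d (A n w))) p\<bar> > \<epsilon>})
      \<longlonglongrightarrow> 0"
proof (intro allI impI)
  fix \<epsilon> :: real assume "0 < \<epsilon>"
  have "smooth_half r"
    using \<open>revenue_function r R\<close> by (simp add: revenue_function_def)
  interpret local_experiment M \<rho> \<B> \<nu> f \<omega> r \<Omega> d A D B Z S eps p \<zeta> \<alpha> \<zeta>n
    by (rule local_experiment.intro; fact)
  from estimate_converges[OF \<open>0 < \<epsilon>\<close>]
  show "(\<lambda>n. measure (M n) {w \<in> space (M n).
       \<bar>Gamma_hat p \<omega> r (D n w / real n) (average n (\<lambda>i. Z n i w))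
            (Delta_hat n (\<zeta>n n) (\<lambda>i. Z n i w) (\<lambda>i. eps n i w))
          - deriv (mf_utility r f \<omega> (\<nu> (A n w)) (d (A n w))) p\<bar> > \<epsilon>})
      \<longlonglongrightarrow> 0" .
qed

end
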